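(* Let $M$ be a $C^1$ Finsler manifold modeled on a Banach space $(X,\|\cdot\|)$ that admits a $C^1$ Lipschitz bump function. Let $f,g\colon M\to\mathbb{R}$ be two functions such that $f$ is lower semicontinuous and $g$ is locally uniformly continuous. Then, for every $x\in M$, every chart $(U,\varphi)$ with $x\in U$, every $\Delta\in D^-(f+g)(x)$ and every $\varepsilon>0$, there exist $x_1,x_2\in U$, $\Delta_1\in D^-f(x_1)$ and $\Delta_2\in D^-g(x_2)$ such that (1) $d(x_1,x)<\varepsilon$ and $d(x_2,x)<\varepsilon$; (2) $|f(x_1)-f(x)|<\varepsilon$ and $|g(x_2)-g(x)|<\varepsilon$; (3) $\|\Delta_1\circ d\varphi(x_1)^{-1}+\Delta_2\circ d\varphi(x_2)^{-1}-\Delta\circ d\varphi(x)^{-1}\|<\varepsilon$; (4) $d(x_1,x_2)\cdot\max\{\|\Delta_1\circ d\varphi(x_1)^{-1}\|,\ \|\Delta_2\circ d\varphi(x_2)^{-1}\|\}<\varepsilon$. Here the norms in (3) and (4) are the dual norm of $X^*$.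
   Context: $C^1$ Finsler manifold (in the sense of Palais): a connected, paracompact $C^1$ Banach manifold $M$ modeled on a Banach space $(X,\|\cdot\|)$, with a continuous map $\|\cdot\|_M:TM\to[0,\infty)$ such that: (P1) for every $x\in M$ the restriction $\|\cdot\|_x$ of $\|\cdot\|_M$ to $T_xM$ is a norm such that for every chart $\varphi:U\to X$ with $x\in U$, the norm $v\in X\mapsto\|d\varphi^{-1}(\varphi(x))(v)\|_x$ is equivalent to $\|\cdot\|$; (P2) for every $x_0\in M$, $\varepsilon>0$ and chart $\varphi:U\to X$ with $x_0\in U$ there is an open neighborhood $W$ of $x_0$ such that for all $x\in W$, $v\in X$, $\frac{1}{1+\varepsilon}\|d\varphi^{-1}(\varphi(x_0))(v)\|_{x_0}\le\|d\varphi^{-1}(\varphi(x))(v)\|_x\le(1+\varepsilon)\|d\varphi^{-1}(\varphi(x_0))(v)\|_{x_0}$. Finsler metric: $d(p,q)$ is the infimum of the lengths $\ell(c)=\int_a^b\|c'(t)\|_{c(t)}\,dt$ over piecewise $C^1$ paths $c:[a,b]\to M$ connecting $p$ to $q$. $C^1$ Lipschitz bump function on $X$: a $C^1$, Lipschitz function $b:X\to\mathbb{R}$ with bounded, non-empty support. Subdifferential: for a function $f:M\to(-\infty,+\infty]$ and $x$ with $f(x)<\infty$, $D^-f(x)=\{dg(x): g:M\to\mathbb{R}\text{ is }C^1\text{ and }f-g\text{ attains a local minimum at }x\}\subset T_xM^*$. "Locally uniformly continuous" means that every point has a neighborhood on which the function is uniformly continuous with respect to $d$. *)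

theory Defs
  imports "HOL-Analysis.Analysis"
begin

section \<open>Manifolds of class $C^1$ modelled on a Banach space\<close>

text \<open>
  The manifold is a type \<open>'m\<close>, the model space is a type \<open>'x\<close>. A chart is a pair of an open domain
  and a total function that is only relevant on this domain.
\<close>

type_synonym ('m, 'x) chart = "'m set \<times> ('m \<Rightarrow> 'x)"

definition C1_on :: "'a::real_normed_vector set \<Rightarrow> ('a \<Rightarrow> 'b::real_normed_vector) \<Rightarrow> bool" where
  "C1_on S f \<longleftrightarrow> (\<exists>f' :: 'a \<Rightarrow> 'a \<Rightarrow>\<^sub>L 'b.
     (\<forall>y\<in>S. (f has_derivative blinfun_apply (f' y)) (at y)) \<and> continuous_on S f')"

definition is_chart :: "('m::topological_space, 'x::real_normed_vector) chart \<Rightarrow> bool" where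
  "is_chart = (\<lambda>(U, \<phi>). open U \<and> open (\<phi> ` U) \<and> homeomorphism U (\<phi> ` U) \<phi> (inv_into U \<phi>))"

definition C1_compatible ::
    "('m, 'x::real_normed_vector) chart \<Rightarrow> ('m, 'x) chart \<Rightarrow> bool" where
  "C1_compatible = (\<lambda>(U, \<phi>) (V, \<psi>).
     C1_on (\<phi> ` (U \<inter> V)) (\<psi> \<circ> inv_into U \<phi>) \<and> C1_on (\<psi> ` (U \<inter> V)) (\<phi> \<circ> inv_into V \<psi>))"

definition C1_atlas :: "('m::topological_space, 'x::real_normed_vector) chart set \<Rightarrow> bool" where
  "C1_atlas A \<longleftrightarrow> (\<forall>c\<in>A. is_chart c) \<and> \<Union> (fst ` A) = UNIV \<and> (\<forall>c\<in>A. \<forall>c'\<in>A. C1_compatible c c')"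

text \<open>The charts of the manifold are those of the maximal atlas generated by \<open>A\<close>.\<close>

definition charts ::
    "('m::topological_space, 'x::real_normed_vector) chart set \<Rightarrow> ('m, 'x) chart set" where
  "charts A = {c. is_chart c \<and> (\<forall>c'\<in>A. C1_compatible c c')}"

definition paracompact_space :: "'m::topological_space itself \<Rightarrow> bool" where
  "paracompact_space _ \<longleftrightarrow> (\<forall>\<C> :: 'm set set. (\<forall>C\<in>\<C>. open C) \<and> \<Union> \<C> = UNIV \<longrightarrow>
     (\<exists>\<D>. (\<forall>D\<in>\<D>. open D \<and> (\<exists>C\<in>\<C>. D \<subseteq> C)) \<and> \<Union> \<D> = UNIV \<and> locally_finite_in euclidean \<D>))"


section \<open>Tangent spaces\<close>

text \<open>
  A tangent vector at \<open>x\<close> is an equivalence class of pairs \<open>((U, \<phi>), v)\<close> of a chart at \<open>x\<close> and a vector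
  of the model space, where \<open>((U, \<phi>), v)\<close> and \<open>((V, \<psi>), w)\<close> are identified iff
  $w = D(\psi \circ \varphi^{-1})(\varphi(x))\,v$. Hence every tangent vector contains exactly one
  pair for each chart at \<open>x\<close>, and the vector space structure acts componentwise.
\<close>

type_synonym ('m, 'x) tangent = "(('m, 'x) chart \<times> 'x) set"

definition tangent_rel ::
    "('m::topological_space, 'x::real_normed_vector) chart set \<Rightarrow> 'm
       \<Rightarrow> ((('m, 'x) chart \<times> 'x) \<times> (('m, 'x) chart \<times> 'x)) set" where
  "tangent_rel A x = {(((U, \<phi>), v), ((V, \<psi>), w)) | U \<phi> v V \<psi> w.
     (U, \<phi>) \<in> charts A \<and> (V, \<psi>) \<in> charts A \<and> x \<in> U \<and> x \<in> V \<and>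
     w = frechet_derivative (\<psi> \<circ> inv_into U \<phi>) (at (\<phi> x)) v}"

definition tangent_space ::
    "('m::topological_space, 'x::real_normed_vector) chart set \<Rightarrow> 'm \<Rightarrow> ('m, 'x) tangent set" where
  "tangent_space A x = {((U, \<phi>), v) | U \<phi> v. (U, \<phi>) \<in> charts A \<and> x \<in> U} // tangent_rel A x"

definition tangent_zero ::
    "('m::topological_space, 'x::real_normed_vector) chart set \<Rightarrow> 'm \<Rightarrow> ('m, 'x) tangent" where
  "tangent_zero A x = {((U, \<phi>), 0) | U \<phi>. (U, \<phi>) \<in> charts A \<and> x \<in> U}"

definition tangent_plus ::
    "('m, 'x::real_normed_vector) tangent \<Rightarrow> ('m, 'x) tangent \<Rightarrow> ('m, 'x) tangent" where
  "tangent_plus \<xi> \<eta> = {(c, v + w) | c v w. (c, v) \<in> \<xi> \<and> (c, w) \<in> \<eta>}"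

definition tangent_scale ::
    "real \<Rightarrow> ('m, 'x::real_normed_vector) tangent \<Rightarrow> ('m, 'x) tangent" where
  "tangent_scale r \<xi> = {(c, r *\<^sub>R v) | c v. (c, v) \<in> \<xi>}"

text \<open>
  The differential $d\varphi(x) : T_xM \to X$ of a chart, and its inverse
  $d\varphi(x)^{-1} = d\varphi^{-1}(\varphi(x)) : X \to T_xM$.
\<close>

definition chart_deriv ::
    "('m, 'x::real_normed_vector) chart \<Rightarrow> ('m, 'x) tangent \<Rightarrow> 'x" where
  "chart_deriv c \<xi> = (THE v. (c, v) \<in> \<xi>)"

definition chart_deriv_inv ::
    "('m::topological_space, 'x::real_normed_vector) chart set \<Rightarrow> ('m, 'x) chart \<Rightarrow> 'm
       \<Rightarrow> 'x \<Rightarrow> ('m, 'x) tangent" where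
  "chart_deriv_inv A c x v = tangent_rel A x `` {(c, v)}"

lemma chart_deriv_chart_deriv_inv:
  assumes "c \<in> charts A" "x \<in> fst c"
  shows "chart_deriv c (chart_deriv_inv A c x v) = v"
proof -
  obtain U \<phi> where c: "c = (U, \<phi>)" by (cases c)
  have ch: "open (\<phi> ` U)" "\<And>y. y \<in> \<phi> ` U \<Longrightarrow> \<phi> (inv_into U \<phi> y) = y"
    using assms by (auto simp: c charts_def is_chart_def f_inv_into_f)
  have "((\<phi> \<circ> inv_into U \<phi>) has_derivative (\<lambda>v. v)) (at (\<phi> x))"
    by (rule has_derivative_transform_within_open[OF has_derivative_ident ch(1)])
       (use assms ch in \<open>auto simp: c\<close>)
  then have "frechet_derivative (\<phi> \<circ> inv_into U \<phi>) (at (\<phi> x)) = (\<lambda>v. v)"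
    by (metis frechet_derivative_at)
  with assms show ?thesis
    by (auto simp: c chart_deriv_def chart_deriv_inv_def tangent_rel_def)
qed

definition tangent_bundle ::
    "('m::topological_space, 'x::real_normed_vector) chart set \<Rightarrow> ('m \<times> ('m, 'x) tangent) set" where
  "tangent_bundle A = Sigma UNIV (tangent_space A)"

text \<open>
  The topology of \<open>TM\<close>: a set is open iff its representation in $\varphi(U) \times X$ is open for
  every chart \<open>(U, \<phi>)\<close>.
\<close>

definition open_in_bundle ::
    "('m::topological_space, 'x::real_normed_vector) chart set \<Rightarrow> ('m \<times> ('m, 'x) tangent) set \<Rightarrow> bool"
  where
  "open_in_bundle A W \<longleftrightarrow> W \<subseteq> tangent_bundle A \<and>
     (\<forall>(U, \<phi>)\<in>charts A. open {(\<phi> x, v) | x v. x \<in> U \<and> (x, chart_deriv_inv A (U, \<phi>) x v) \<in> W})"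

lemma istopology_open_in_bundle: "istopology (open_in_bundle A)"
  unfolding istopology_def
proof (intro conjI allI impI)
  fix S T assume S: "open_in_bundle A S" and T: "open_in_bundle A T"
  define R where "R = (\<lambda>(U, \<phi>) W. {(\<phi> x, v) | x v. x \<in> U \<and> (x, chart_deriv_inv A (U, \<phi>) x v) \<in> W})"
  have "open (R c (S \<inter> T))" if c: "c \<in> charts A" for c
  proof -
    obtain U \<phi> where c': "c = (U, \<phi>)" by (cases c)
    have "inj_on \<phi> U"
      using c by (auto simp: c' charts_def is_chart_def homeomorphism_def intro: inj_on_inverseI)
    then have "R c (S \<inter> T) = R c S \<inter> R c T"
      by (auto simp: R_def c' dest: inj_onD)
    moreover have "open (R c S)" "open (R c T)"
      using S T c by (auto simp: R_def c' open_in_bundle_def)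
    ultimately show ?thesis by auto
  qed
  with S show "open_in_bundle A (S \<inter> T)"
    by (auto simp: open_in_bundle_def R_def)
next
  fix \<K> assume K: "\<forall>K\<in>\<K>. open_in_bundle A K"
  have "open {(\<phi> x, v) | x v. x \<in> U \<and> (x, chart_deriv_inv A (U, \<phi>) x v) \<in> \<Union> \<K>}"
    if c: "(U, \<phi>) \<in> charts A" for U \<phi>
  proof -
    have "{(\<phi> x, v) | x v. x \<in> U \<and> (x, chart_deriv_inv A (U, \<phi>) x v) \<in> \<Union> \<K>} =
        (\<Union>K\<in>\<K>. {(\<phi> x, v) | x v. x \<in> U \<and> (x, chart_deriv_inv A (U, \<phi>) x v) \<in> K})"
      by auto
    also have "open \<dots>" using K c by (fastforce simp: open_in_bundle_def)
    finally show ?thesis .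
  qed
  with K show "open_in_bundle A (\<Union> \<K>)"
    by (auto simp: open_in_bundle_def)
qed

definition bundle_topology ::
    "('m::topological_space, 'x::real_normed_vector) chart set \<Rightarrow> ('m \<times> ('m, 'x) tangent) topology" where
  "bundle_topology A = topology (open_in_bundle A)"


section \<open>Finsler structures and the Finsler metric\<close>

definition is_norm_on_tangent_space ::
    "('m::topological_space, 'x::real_normed_vector) chart set \<Rightarrow> 'm
       \<Rightarrow> (('m, 'x) tangent \<Rightarrow> real) \<Rightarrow> bool" where
  "is_norm_on_tangent_space A x n \<longleftrightarrow>
     (\<forall>\<xi>\<in>tangent_space A x. 0 \<le> n \<xi> \<and> (n \<xi> = 0 \<longleftrightarrow> \<xi> = tangent_zero A x)) \<and>
     (\<forall>\<xi>\<in>tangent_space A x. \<forall>\<eta>\<in>tangent_space A x. n (tangent_plus \<xi> \<eta>) \<le> n \<xi> + n \<eta>) \<and>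
     (\<forall>r. \<forall>\<xi>\<in>tangent_space A x. n (tangent_scale r \<xi>) = \<bar>r\<bar> * n \<xi>)"

definition finsler_P1 ::
    "('m::topological_space, 'x::real_normed_vector) chart set
       \<Rightarrow> ('m \<Rightarrow> ('m, 'x) tangent \<Rightarrow> real) \<Rightarrow> bool" where
  "finsler_P1 A N \<longleftrightarrow> (\<forall>x. is_norm_on_tangent_space A x (N x) \<and>
     (\<forall>(U, \<phi>)\<in>charts A. x \<in> U \<longrightarrow>
        (\<exists>k>0. \<exists>K>0. \<forall>v. k * norm v \<le> N x (chart_deriv_inv A (U, \<phi>) x v) \<and>
                         N x (chart_deriv_inv A (U, \<phi>) x v) \<le> K * norm v)))"

definition finsler_P2 ::
    "('m::topological_space, 'x::real_normed_vector) chart set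
       \<Rightarrow> ('m \<Rightarrow> ('m, 'x) tangent \<Rightarrow> real) \<Rightarrow> bool" where
  "finsler_P2 A N \<longleftrightarrow> (\<forall>x0. \<forall>\<epsilon>>0. \<forall>(U, \<phi>)\<in>charts A. x0 \<in> U \<longrightarrow>
     (\<exists>W. open W \<and> x0 \<in> W \<and> W \<subseteq> U \<and> (\<forall>x\<in>W. \<forall>v.
        1 / (1 + \<epsilon>) * N x0 (chart_deriv_inv A (U, \<phi>) x0 v) \<le> N x (chart_deriv_inv A (U, \<phi>) x v) \<and>
        N x (chart_deriv_inv A (U, \<phi>) x v) \<le> (1 + \<epsilon>) * N x0 (chart_deriv_inv A (U, \<phi>) x0 v))))"

text \<open>The Hausdorff axiom is imposed by the sort of \<open>'m\<close>.\<close>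

definition C1_finsler_manifold ::
    "('m::t2_space, 'x::banach) chart set \<Rightarrow> ('m \<Rightarrow> ('m, 'x) tangent \<Rightarrow> real) \<Rightarrow> bool" where
  "C1_finsler_manifold A N \<longleftrightarrow>
     C1_atlas A \<and> connected (UNIV :: 'm set) \<and> paracompact_space TYPE('m) \<and>
     continuous_map (bundle_topology A) euclideanreal (\<lambda>(x, \<xi>). N x \<xi>) \<and>
     finsler_P1 A N \<and> finsler_P2 A N"

text \<open>On a closed interval, \<open>C\<^sup>1\<close> involves one-sided derivatives at the endpoints.\<close>

definition C1_curve_on ::
    "('m::topological_space, 'x::real_normed_vector) chart set \<Rightarrow> real \<Rightarrow> real \<Rightarrow> (real \<Rightarrow> 'm) \<Rightarrow> bool"
  where
  "C1_curve_on A s t c \<longleftrightarrow> continuous_on {s..t} c \<and>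
     (\<forall>(U, \<phi>)\<in>charts A. \<exists>D.
        (\<forall>\<tau>\<in>{s..t}. c \<tau> \<in> U \<longrightarrow> ((\<phi> \<circ> c) has_vector_derivative D \<tau>) (at \<tau> within {s..t})) \<and>
        continuous_on {\<tau>\<in>{s..t}. c \<tau> \<in> U} D)"

definition piecewise_C1_curve_on ::
    "('m::topological_space, 'x::real_normed_vector) chart set \<Rightarrow> real \<Rightarrow> real \<Rightarrow> (real \<Rightarrow> 'm) \<Rightarrow> bool"
  where
  "piecewise_C1_curve_on A a b c \<longleftrightarrow> (\<exists>(n::nat) (s::nat \<Rightarrow> real). s 0 = a \<and> s n = b \<and>
     (\<forall>i<n. s i < s (Suc i) \<and> C1_curve_on A (s i) (s (Suc i)) c))"

text \<open>
  At the finitely many break points of a piecewise \<open>C\<^sup>1\<close> path the velocity is a dummy value, which does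
  not affect the length.
\<close>

definition velocity ::
    "('m::topological_space, 'x::real_normed_vector) chart set \<Rightarrow> real \<Rightarrow> real \<Rightarrow> (real \<Rightarrow> 'm)
       \<Rightarrow> real \<Rightarrow> ('m, 'x) tangent" where
  "velocity A a b c t = {((U, \<phi>), vector_derivative (\<phi> \<circ> c) (at t within {a..b})) | U \<phi>.
     (U, \<phi>) \<in> charts A \<and> c t \<in> U}"

definition curve_length ::
    "('m::topological_space, 'x::real_normed_vector) chart set
       \<Rightarrow> ('m \<Rightarrow> ('m, 'x) tangent \<Rightarrow> real) \<Rightarrow> real \<Rightarrow> real \<Rightarrow> (real \<Rightarrow> 'm) \<Rightarrow> real" where
  "curve_length A N a b c = integral {a..b} (\<lambda>t. N (c t) (velocity A a b c t))"

definition finsler_dist ::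
    "('m::topological_space, 'x::real_normed_vector) chart set
       \<Rightarrow> ('m \<Rightarrow> ('m, 'x) tangent \<Rightarrow> real) \<Rightarrow> 'm \<Rightarrow> 'm \<Rightarrow> real" where
  "finsler_dist A N p q = Inf {curve_length A N a b c | a b c.
     a < b \<and> piecewise_C1_curve_on A a b c \<and> c a = p \<and> c b = q}"


section \<open>Functions on the manifold\<close>

definition C1_fun ::
    "('m::topological_space, 'x::real_normed_vector) chart set \<Rightarrow> ('m \<Rightarrow> real) \<Rightarrow> bool" where
  "C1_fun A g \<longleftrightarrow> (\<forall>(U, \<phi>)\<in>charts A. C1_on (\<phi> ` U) (g \<circ> inv_into U \<phi>))"

text \<open>
  $dg(x)(\xi) = D(g \circ \varphi^{-1})(\varphi(x))\,v$ for any \<open>((U, \<phi>), v) \<in> \<xi>\<close>; it is \<open>undefined\<close> outside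
  $T_xM$.
\<close>

definition differential ::
    "('m::topological_space, 'x::real_normed_vector) chart set \<Rightarrow> ('m \<Rightarrow> real) \<Rightarrow> 'm
       \<Rightarrow> ('m, 'x) tangent \<Rightarrow> real" where
  "differential A g x = (\<lambda>\<xi>\<in>tangent_space A x.
     THE r. \<exists>U \<phi> v. ((U, \<phi>), v) \<in> \<xi> \<and> r = frechet_derivative (g \<circ> inv_into U \<phi>) (at (\<phi> x)) v)"

definition local_min_at :: "('m::topological_space \<Rightarrow> ereal) \<Rightarrow> 'm \<Rightarrow> bool" where
  "local_min_at h x \<longleftrightarrow> (\<exists>W. open W \<and> x \<in> W \<and> (\<forall>y\<in>W. h x \<le> h y))"

definition subdiff ::
    "('m::topological_space, 'x::real_normed_vector) chart set \<Rightarrow> ('m \<Rightarrow> ereal) \<Rightarrow> 'm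
       \<Rightarrow> (('m, 'x) tangent \<Rightarrow> real) set" where
  "subdiff A f x = {differential A g x | g.
     f x < \<infinity> \<and> C1_fun A g \<and> local_min_at (\<lambda>y. f y - ereal (g y)) x}"

definition lower_semicontinuous :: "('m::topological_space \<Rightarrow> real) \<Rightarrow> bool" where
  "lower_semicontinuous f \<longleftrightarrow> (\<forall>a. open {x. a < f x})"

definition locally_uniformly_continuous ::
    "('m::topological_space \<Rightarrow> 'm \<Rightarrow> real) \<Rightarrow> ('m \<Rightarrow> real) \<Rightarrow> bool" where
  "locally_uniformly_continuous d g \<longleftrightarrow> (\<forall>x. \<exists>W. open W \<and> x \<in> W \<and>
     (\<forall>e>0. \<exists>\<delta>>0. \<forall>y\<in>W. \<forall>z\<in>W. d y z < \<delta> \<longrightarrow> \<bar>g y - g z\<bar> < e))"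

definition C1_Lipschitz_bump :: "('x::real_normed_vector \<Rightarrow> real) \<Rightarrow> bool" where
  "C1_Lipschitz_bump b \<longleftrightarrow> C1_on UNIV b \<and> (\<exists>L. L-lipschitz_on UNIV b) \<and>
     bounded (closure {v. b v \<noteq> 0}) \<and> closure {v. b v \<noteq> 0} \<noteq> {}"

text \<open>
  The representation $\Delta \circ d\varphi(x)^{-1}$ of a cotangent vector at \<open>x\<close> in a chart; its dual norm
  is \<^const>\<open>onorm\<close>.
\<close>

definition cotangent_rep ::
    "('m::topological_space, 'x::real_normed_vector) chart set \<Rightarrow> ('m, 'x) chart \<Rightarrow> 'm
       \<Rightarrow> (('m, 'x) tangent \<Rightarrow> real) \<Rightarrow> 'x \<Rightarrow> real" where
  "cotangent_rep A c x \<Delta> = \<Delta> \<circ> chart_deriv_inv A c x"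

end

theory Submission
  imports Defs
begin

text \<open>
  A bump function yields a $C^1$ function $\theta$ on the model space that behaves near \<open>0\<close> like the square of the
  norm. In the chart one minimises, after a small smooth perturbation,
  $f(y) + g(z) - h(y) + n\,\theta(y - z) + \delta\,\theta(y - a)$, where $h$ is a test function for
  $f + g$ at the centre $a$. As $n \to \infty$ the minimisers tend to $(a, a)$ and the penalty
  $n\,\theta(y - z)$ tends to \<open>0\<close> by uniform continuity of $g$; the partial derivatives of the
  perturbation are the required subgradients up to a small error. Test functions in the chart extend to the
  manifold because a paracompact Hausdorff space is regular. Only the upper bound of the Finsler
  distance by the norm in the chart, which comes from line segments, is needed.
\<close>

section \<open>Calculus of $C^1$ functions\<close>

text \<open>Condition (4) shapes the penalty. For \<open>u = y - z\<close>, an arbitrary smooth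
  penalty could force \<open>u\<close> to 0 and still leave
  \<open>norm u * norm (n *\<^sub>R \<theta>' u)\<close> uncontrolled. The bounds
  \<open>norm (\<theta>' u) \<le> C * norm u\<close> and, near 0,
  \<open>(norm u)\<^sup>2 \<le> 4 * \<theta> u\<close> dominate this product by 4 C times the
  penalty \<open>n * \<theta> u\<close> itself. The given norm may fail to be differentiable, so
  such a gauge has to be assembled from rescaled bumps. Balls of the model space need not be
  compact, so a minimum is only available after a perturbation. Measuring distance in the product by
  the sum of the gauges of both coordinates makes the perturbation a function of y plus a function
  of z, hence compatible with partial derivatives. The weight \<delta> depends on \<epsilon> but not
  on n: the perturbation errors in (3) stay below \<epsilon> without tending to 0. Convergence to
  the centre comes from comparing with the value at (a, a): both \<open>n * \<theta> (y - z)\<close>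
  and \<open>\<delta> * \<theta> (y - a)\<close> are at most g(y) - g(z).\<close>

lemma C1_on_subset: "C1_on S f \<Longrightarrow> T \<subseteq> S \<Longrightarrow> C1_on T f"
  unfolding C1_on_def by (meson continuous_on_subset subsetD)

lemma C1_on_imp_continuous_on: "C1_on S f \<Longrightarrow> continuous_on S f"
  unfolding C1_on_def
  by (meson continuous_at_imp_continuous_on has_derivative_continuous)

lemma C1_on_imp_differentiable: "C1_on S f \<Longrightarrow> x \<in> S \<Longrightarrow> f differentiable (at x)"
  unfolding C1_on_def differentiable_def by blast

text \<open>\<open>C1_on\<close> demands one derivative map on all of \<open>S\<close>. Uniqueness
  of derivatives makes the local derivative maps agree with a pointwise choice, and openness of each
  \<open>T\<close> turns continuity on \<open>T\<close> into continuity at the point.\<close>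

lemma C1_on_open_cover:
  assumes "\<And>x. x \<in> S \<Longrightarrow> \<exists>T. open T \<and> x \<in> T \<and> C1_on T f"
  shows "C1_on S f"
proof -
  define f' where "f' x = (SOME D. (f has_derivative blinfun_apply D) (at x))" for x
  have f'_eq: "f' x = D" if "(f has_derivative blinfun_apply D) (at x)" for x D
  proof -
    have "(f has_derivative blinfun_apply (f' x)) (at x)"
      unfolding f'_def by (rule someI) (rule that)
    then have "blinfun_apply (f' x) = blinfun_apply D"
      by (rule has_derivative_unique[OF _ that])
    then show ?thesis by (simp add: blinfun_apply_inject)
  qed
  have "(f has_derivative blinfun_apply (f' x)) (at x) \<and> isCont f' x" if x: "x \<in> S" for x
  proof -
    obtain T where T: "open T" "x \<in> T" "C1_on T f" using assms[OF x] by blast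
    then obtain g' where g': "\<And>y. y \<in> T \<Longrightarrow> (f has_derivative blinfun_apply (g' y)) (at y)"
        "continuous_on T g'"
      unfolding C1_on_def by blast
    have eq: "f' y = g' y" if "y \<in> T" for y using f'_eq[OF g'(1)[OF that]] .
    have "continuous_on T f'" using g'(2) eq by (simp cong: continuous_on_cong)
    then have "isCont f' x" using T continuous_on_eq_continuous_at by blast
    with g'(1)[OF T(2)] eq[OF T(2)] show ?thesis by simp
  qed
  then show ?thesis
    unfolding C1_on_def by (intro exI[of _ f']) (auto intro: continuous_at_imp_continuous_on)
qed

lemma C1_on_cong:
  assumes "open S" "C1_on S f" "\<And>x. x \<in> S \<Longrightarrow> f x = g x"
  shows "C1_on S g"
  using assms unfolding C1_on_def
  by (metis has_derivative_transform_within_open)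

lemma C1_on_const: "C1_on S (\<lambda>_. c)"
  unfolding C1_on_def by (intro exI[of _ "\<lambda>_. 0"]) (auto simp: zero_blinfun.rep_eq)

lemma C1_on_compose:
  assumes f: "C1_on S f" and g: "C1_on T g" and sub: "f ` S \<subseteq> T"
  shows "C1_on S (g \<circ> f)"
proof -
  obtain f' where f': "\<And>x. x \<in> S \<Longrightarrow> (f has_derivative blinfun_apply (f' x)) (at x)"
      "continuous_on S f'"
    using f unfolding C1_on_def by blast
  obtain g' where g': "\<And>x. x \<in> T \<Longrightarrow> (g has_derivative blinfun_apply (g' x)) (at x)"
      "continuous_on T g'"
    using g unfolding C1_on_def by blast
  have cf: "continuous_on S f" by (rule C1_on_imp_continuous_on[OF f])
  show ?thesis
    unfolding C1_on_def
  proof (intro exI[of _ "\<lambda>x. g' (f x) o\<^sub>L f' x"] conjI ballI)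
    fix x assume x: "x \<in> S"
    have "(g has_derivative blinfun_apply (g' (f x))) (at (f x))"
      using g'(1) sub x by blast
    from diff_chain_at[OF f'(1)[OF x] this]
    show "(g \<circ> f has_derivative blinfun_apply (g' (f x) o\<^sub>L f' x)) (at x)"
      by (simp add: blinfun_compose.rep_eq)
    next
    show "continuous_on S (\<lambda>x. g' (f x) o\<^sub>L f' x)"
      by (intro continuous_intros f'(2) continuous_on_compose2[OF g'(2) cf] sub)
  qed
qed

lemma C1_on_mult:
  fixes f g :: "'a::real_normed_vector \<Rightarrow> real"
  assumes f: "C1_on S f" and g: "C1_on S g"
  shows "C1_on S (\<lambda>x. f x * g x)"
proof -
  obtain f' where f': "\<And>x. x \<in> S \<Longrightarrow> (f has_derivative blinfun_apply (f' x)) (at x)"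
      "continuous_on S f'"
    using f unfolding C1_on_def by blast
  obtain g' where g': "\<And>x. x \<in> S \<Longrightarrow> (g has_derivative blinfun_apply (g' x)) (at x)"
      "continuous_on S g'"
    using g unfolding C1_on_def by blast
  show ?thesis
    unfolding C1_on_def
  proof (intro exI[of _ "\<lambda>x. f x *\<^sub>R g' x + g x *\<^sub>R f' x"] conjI ballI)
    fix x assume x: "x \<in> S"
    have "((\<lambda>x. f x * g x) has_derivative (\<lambda>h. f x * g' x h + f' x h * g x)) (at x)"
      by (rule has_derivative_mult[OF f'(1)[OF x] g'(1)[OF x]])
    then show "((\<lambda>x. f x * g x) has_derivative blinfun_apply (f x *\<^sub>R g' x + g x *\<^sub>R f' x)) (at x)"
      by (rule has_derivative_eq_rhs) (simp add: fun_eq_iff blinfun.add_left blinfun.scaleR_left)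
  next
    show "continuous_on S (\<lambda>x. f x *\<^sub>R g' x + g x *\<^sub>R f' x)"
      using C1_on_imp_continuous_on[OF f] C1_on_imp_continuous_on[OF g] f'(2) g'(2)
      by (intro continuous_intros)
  qed
qed

text \<open>The Weierstrass test gives uniform convergence of the series of derivatives, hence
  continuity of its sum and termwise differentiation. It serves both the dyadic gauge and the
  perturbations of the variational principle.\<close>

lemma has_derivative_suminf:
  fixes f :: "nat \<Rightarrow> 'a::real_normed_vector \<Rightarrow> 'b::banach" and f' :: "nat \<Rightarrow> 'a \<Rightarrow> 'a \<Rightarrow>\<^sub>L 'b"
  assumes f': "\<And>k x. (f k has_derivative blinfun_apply (f' k x)) (at x)"
    and cont: "\<And>k. continuous_on UNIV (f' k)"
    and bound: "\<And>k x. norm (f' k x) \<le> M k" and M: "summable M"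
    and sm: "\<And>x. summable (\<lambda>k. f k x)"
  shows "((\<lambda>x. \<Sum>k. f k x) has_derivative blinfun_apply (\<Sum>k. f' k x)) (at x)"
    and "continuous_on UNIV (\<lambda>x. \<Sum>k. f' k x)"
    and "norm (\<Sum>k. f' k x) \<le> suminf M"
proof -
  have unif: "uniform_limit UNIV (\<lambda>n x. \<Sum>k<n. f' k x) (\<lambda>x. \<Sum>k. f' k x) sequentially"
    by (rule Weierstrass_m_test[OF _ M]) (use bound in auto)
  show "continuous_on UNIV (\<lambda>x. \<Sum>k. f' k x)"
    by (rule uniform_limit_theorem[OF _ unif]) (auto intro!: always_eventually continuous_intros cont)
  have sf': "summable (\<lambda>k. f' k x)" for x
    by (rule summable_comparison_test[OF _ M]) (use bound in auto)
  have "norm (\<Sum>k. f' k x) \<le> (\<Sum>k. norm (f' k x))"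
    by (rule summable_norm[OF summable_comparison_test[OF _ M]]) (use bound in auto)
  also have "\<dots> \<le> suminf M"
    by (rule suminf_le[OF _ summable_comparison_test[OF _ M] M]) (use bound in auto)
  finally show "norm (\<Sum>k. f' k x) \<le> suminf M" .
  have "\<exists>g. \<forall>x\<in>UNIV. (\<lambda>n. f n x) sums g x \<and>
      (g has_derivative blinfun_apply (\<Sum>k. f' k x)) (at x within UNIV)"
  proof (rule has_derivative_series)
    show "\<forall>\<^sub>F n in sequentially. \<forall>x\<in>UNIV. \<forall>h.
        norm ((\<Sum>i<n. blinfun_apply (f' i x) h) - blinfun_apply (\<Sum>k. f' k x) h) \<le> e * norm h"
      if "e > 0" for e
    proof -
      have "\<forall>\<^sub>F n in sequentially. \<forall>x\<in>UNIV. dist (\<Sum>k<n. f' k x) (\<Sum>k. f' k x) < e"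
        using uniform_limitD[OF unif that] .
      then show ?thesis
      proof (eventually_elim, intro ballI allI)
        fix n x h assume "\<forall>x\<in>UNIV. dist (\<Sum>k<n. f' k x) (\<Sum>k. f' k x) < e"
        then have "norm ((\<Sum>k<n. f' k x) - (\<Sum>k. f' k x)) \<le> e"
          by (auto simp: dist_norm intro: less_imp_le)
        then have "norm (blinfun_apply ((\<Sum>k<n. f' k x) - (\<Sum>k. f' k x)) h) \<le> e * norm h"
          by (meson mult_right_mono norm_blinfun norm_ge_zero order_trans)
        then show "norm ((\<Sum>i<n. blinfun_apply (f' i x) h) - blinfun_apply (\<Sum>k. f' k x) h) \<le> e * norm h"
          by (simp add: blinfun.diff_left blinfun.sum_left)
      qed
    qed
  qed (use f' sm in \<open>auto intro: summable_sums\<close>)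
  then obtain g where g: "\<And>x. (\<lambda>n. f n x) sums g x"
      "\<And>x. (g has_derivative blinfun_apply (\<Sum>k. f' k x)) (at x)"
    by auto
  have "g = (\<lambda>x. \<Sum>k. f k x)" using g(1) by (auto simp: fun_eq_iff sums_unique)
  with g(2) show "((\<lambda>x. \<Sum>k. f k x) has_derivative blinfun_apply (\<Sum>k. f' k x)) (at x)" by simp
qed

text \<open>The difference quotients along the line through \<open>u\<close> in direction
  \<open>h\<close> are bounded by \<open>L * norm h\<close>, and so is their limit.\<close>

lemma norm_derivative_le_lipschitz:
  fixes f :: "'a::real_normed_vector \<Rightarrow> real"
  assumes f': "(f has_derivative blinfun_apply f') (at u)" and L: "L-lipschitz_on UNIV f"
  shows "norm f' \<le> L"
proof (rule norm_blinfun_bound)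
  show "0 \<le> L" using L by (rule lipschitz_on_nonneg)
  fix h
  have "((\<lambda>t::real. u + t *\<^sub>R h) has_derivative (\<lambda>t. t *\<^sub>R h)) (at 0)"
    by (auto intro!: derivative_eq_intros)
  moreover have "(f has_derivative blinfun_apply f') (at (u + 0 *\<^sub>R h))" using f' by simp
  ultimately have "(f \<circ> (\<lambda>t. u + t *\<^sub>R h) has_derivative blinfun_apply f' \<circ> (\<lambda>t. t *\<^sub>R h)) (at 0)"
    by (rule diff_chain_at)
  then have "((\<lambda>t. f (u + t *\<^sub>R h)) has_real_derivative f' h) (at 0)"
    unfolding has_field_derivative_def o_def
    by (rule has_derivative_eq_rhs) (simp add: fun_eq_iff blinfun.scaleR_right)
  then have "((\<lambda>t. (f (u + t *\<^sub>R h) - f u) / t) \<longlongrightarrow> f' h) (at 0)"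
    by (simp add: DERIV_def)
  moreover have "\<forall>\<^sub>F t in at 0. norm ((f (u + t *\<^sub>R h) - f u) / t) \<le> L * norm h"
    unfolding eventually_at_filter
  proof (intro always_eventually allI impI)
    fix t :: real assume t: "t \<noteq> 0"
    have "\<bar>f (u + t *\<^sub>R h) - f u\<bar> \<le> L * norm (t *\<^sub>R h)"
      using lipschitz_onD[OF L, of "u + t *\<^sub>R h" u] by (simp add: dist_norm)
    then show "norm ((f (u + t *\<^sub>R h) - f u) / t) \<le> L * norm h"
      using t by (simp add: field_simps)
  qed
  ultimately show "norm (f' h) \<le> L * norm h"
    by (intro Lim_norm_ubound) auto
qed


section \<open>Smooth gauges\<close>

text \<open>Squaring removes the corner of the positive part: at 0 the difference quotient is
  \<open>max 0 h\<close>. Thus a $C^1$ function can be truncated from below and remain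
  $C^1$.\<close>

lemma DERIV_max_0_power2:
  "((\<lambda>s::real. (max 0 s)\<^sup>2) has_real_derivative 2 * max 0 s) (at s)"
proof -
  consider "s > 0" | "s < 0" | "s = 0" by linarith
  then show ?thesis
  proof cases
    case 1
    have "((\<lambda>s::real. s\<^sup>2) has_real_derivative 2 * s) (at s)"
      by (auto intro!: derivative_eq_intros)
    then have "((\<lambda>s::real. (max 0 s)\<^sup>2) has_real_derivative 2 * s) (at s)"
      by (rule has_field_derivative_transform_within_open[of _ _ _ "{0<..}"]) (use 1 in auto)
    then show ?thesis using 1 by simp
  next
    case 2
    have "((\<lambda>s::real. 0) has_real_derivative 0) (at s)" by simp
    then have "((\<lambda>s::real. (max 0 s)\<^sup>2) has_real_derivative 0) (at s)"
      by (rule has_field_derivative_transform_within_open[of _ _ _ "{..<0}"]) (use 2 in auto)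
    then show ?thesis using 2 by simp
  next
    case 3
    have "((\<lambda>h. max 0 h) \<longlongrightarrow> max 0 (0::real)) (at 0)"
      by (intro tendsto_intros)
    moreover have "\<forall>\<^sub>F h in at (0::real). max 0 h = (max 0 h)\<^sup>2 / h"
      by (auto simp: eventually_at_filter max_def power2_eq_square)
    ultimately have "((\<lambda>h. (max 0 h)\<^sup>2 / h) \<longlongrightarrow> (0::real)) (at 0)"
      by (auto elim: Lim_transform_eventually)
    then show ?thesis using 3 by (simp add: DERIV_def)
  qed
qed

text \<open>A bounded $C^1$ stand-in for the squared norm. \<open>upper\<close> and
  \<open>deriv_bound\<close> make weighted series of translates converge with small derivative;
  \<open>lower\<close> and \<open>deriv_linear\<close> together compare
  \<open>norm u * norm (\<theta>' u)\<close> with \<open>\<theta> u\<close> near 0.\<close>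

locale smooth_gauge =
  fixes \<theta> :: "'x::banach \<Rightarrow> real" and \<theta>' :: "'x \<Rightarrow> 'x \<Rightarrow>\<^sub>L real" and C :: real
  assumes C_pos: "0 < C"
    and deriv: "\<And>u. (\<theta> has_derivative blinfun_apply (\<theta>' u)) (at u)"
    and cont_deriv: "continuous_on UNIV \<theta>'"
    and zero: "\<theta> 0 = 0"
    and lower: "\<And>u. min 1 ((norm u)\<^sup>2) / 4 \<le> \<theta> u"
    and upper: "\<And>u. \<theta> u \<le> C"
    and deriv_bound: "\<And>u. norm (\<theta>' u) \<le> C"
    and deriv_linear: "\<And>u. norm (\<theta>' u) \<le> C * norm u"

text \<open>
  Cut-offs at the scales $2^{-k}$, weighted by $4^{-k}$, add up to a $C^1$ substitute for the square
  of the norm. The self-similarity $\theta(u) = \beta(u) + \theta(2u)/4$ gives the estimates at all scales.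
\<close>

lemma dyadic_gauge:
  fixes \<beta> :: "'x::banach \<Rightarrow> real" and \<beta>' :: "'x \<Rightarrow> 'x \<Rightarrow>\<^sub>L real"
  assumes deriv: "\<And>u. (\<beta> has_derivative blinfun_apply (\<beta>' u)) (at u)"
    and cont: "continuous_on UNIV \<beta>'"
    and nonneg: "\<And>u. 0 \<le> \<beta> u" and bd: "\<And>u. \<beta> u \<le> B" and bd': "\<And>u. norm (\<beta>' u) \<le> L"
    and \<rho>: "\<rho> > 0" and near: "\<And>u. norm u < \<rho> \<Longrightarrow> \<beta> u = 0"
    and far: "\<And>u. norm u \<ge> 1 \<Longrightarrow> \<beta> u = 1"
  shows "\<exists>\<theta> \<theta>' C. smooth_gauge (\<theta> :: 'x \<Rightarrow> real) \<theta>' C"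
proof -
  define f where "f k u = (1/4)^k * \<beta> (2^k *\<^sub>R u)" for k :: nat and u
  \<comment> \<open>The chain rule contributes 2^k, so the weight 4^-k becomes 2^-k, which is still
    summable.\<close>
  define f' where "f' k u = (1/2)^k *\<^sub>R \<beta>' (2^k *\<^sub>R u)" for k :: nat and u
  define \<theta> where "\<theta> u = (\<Sum>k. f k u)" for u
  define \<theta>' where "\<theta>' u = (\<Sum>k. f' k u)" for u
  have B: "0 \<le> B" using nonneg bd order_trans by blast
  have L: "0 \<le> L" using bd' norm_ge_zero order_trans by blast
  have four: "(1/4::real)^k * 2^k = (1/2)^k" for k :: nat
    by (simp flip: power_mult_distrib)
  have df: "(f k has_derivative blinfun_apply (f' k u)) (at u)" for k u
  proof -
    have "((\<lambda>u. 2^k *\<^sub>R u) has_derivative (\<lambda>h. 2^k *\<^sub>R h)) (at u)"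
      by (auto intro!: derivative_eq_intros)
    from diff_chain_at[OF this deriv]
    have "((\<lambda>u. \<beta> (2^k *\<^sub>R u)) has_derivative (\<lambda>h. \<beta>' (2^k *\<^sub>R u) (2^k *\<^sub>R h))) (at u)"
      by (simp add: o_def)
    then have "((\<lambda>u. (1/4)^k * \<beta> (2^k *\<^sub>R u)) has_derivative
        (\<lambda>h. (1/4)^k * \<beta>' (2^k *\<^sub>R u) (2^k *\<^sub>R h))) (at u)"
      by (rule has_derivative_mult_right)
    then show ?thesis
      unfolding f_def[abs_def]
      by (rule has_derivative_eq_rhs)
         (simp add: fun_eq_iff f'_def blinfun.scaleR_left blinfun.scaleR_right four flip: mult.assoc)
  qed
  have cf: "continuous_on UNIV (f' k)" for k
    unfolding f'_def by (intro continuous_intros continuous_on_compose2[OF cont]) auto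
  have nf': "norm (f' k u) \<le> L * (1/2)^k" for k u
    using bd'[of "2^k *\<^sub>R u"] by (simp add: f'_def mult.commute mult_right_mono)
  have sL: "summable (\<lambda>k. L * (1/2)^k)" by (intro summable_mult summable_geometric) auto
  have f0: "0 \<le> f k u" "f k u \<le> B * (1/4)^k" for k u
    using nonneg bd[of "2^k *\<^sub>R u"] by (auto simp: f_def mult.commute mult_right_mono)
  have sB: "summable (\<lambda>k. B * (1/4::real)^k)" by (intro summable_mult summable_geometric) auto
  have sf: "summable (\<lambda>k. f k u)" for u
    by (rule summable_comparison_test[OF _ sB]) (use f0 in auto)
  note series = has_derivative_suminf[OF df cf nf' sL sf, folded \<theta>_def \<theta>'_def]
  have \<theta>_nonneg: "0 \<le> \<theta> u" for u unfolding \<theta>_def by (rule suminf_nonneg[OF sf f0(1)])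
  have rec: "\<theta> u = \<beta> u + \<theta> (2 *\<^sub>R u) / 4" for u
  proof -
    have "(\<Sum>k. f (Suc k) u) = (\<Sum>k. f k (2 *\<^sub>R u) / 4)"
      by (intro suminf_cong) (simp add: f_def mult.commute)
    also have "\<dots> = \<theta> (2 *\<^sub>R u) / 4" unfolding \<theta>_def by (rule suminf_divide[OF sf])
    finally show ?thesis
      using suminf_split_head[OF sf, of u] by (simp add: \<theta>_def f_def)
  qed
  \<comment> \<open>Where \<beta> vanishes identically, that is on an open ball, the self-similarity
    can be differentiated; the factor 1/2 is 2/4.\<close>
  have rec': "\<theta>' u = (1/2) *\<^sub>R \<theta>' (2 *\<^sub>R u)" if u: "norm u < \<rho>" for u
  proof (rule blinfun_eqI)
    fix h
    have "((\<lambda>u. 2 *\<^sub>R u) has_derivative (\<lambda>h::'x. 2 *\<^sub>R h)) (at u)"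
      by (auto intro!: derivative_eq_intros)
    from diff_chain_at[OF this series(1)]
    have "((\<lambda>u. \<theta> (2 *\<^sub>R u)) has_derivative (\<lambda>h. \<theta>' (2 *\<^sub>R u) (2 *\<^sub>R h))) (at u)"
      by (simp add: o_def)
    then have half: "((\<lambda>u. \<theta> (2 *\<^sub>R u) / 4) has_derivative (\<lambda>h. \<theta>' (2 *\<^sub>R u) (2 *\<^sub>R h) / 4)) (at u)"
      by (auto intro!: derivative_eq_intros)
    have eq: "\<theta> (2 *\<^sub>R w) / 4 = \<theta> w" if "norm w < \<rho>" for w
      using rec[of w] near[OF that] by simp
    have "(\<theta> has_derivative (\<lambda>h. \<theta>' (2 *\<^sub>R u) (2 *\<^sub>R h) / 4)) (at u)"
      by (rule has_derivative_transform_within_open[OF half, where s = "ball 0 \<rho>"])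
         (use u eq in auto)
    from has_derivative_unique[OF this series(1)]
    show "\<theta>' u h = ((1/2) *\<^sub>R \<theta>' (2 *\<^sub>R u)) h"
      by (simp add: fun_eq_iff blinfun.scaleR_left blinfun.scaleR_right)
  qed
  define D where "D = (\<Sum>k. L * (1/2::real)^k)"
  have D: "norm (\<theta>' u) \<le> D" for u using series(3) by (simp add: D_def)
  have D0: "0 \<le> D" using D norm_ge_zero order_trans by blast
  \<comment> \<open>Doubling \<open>u\<close> until its norm reaches \<rho>: there the uniform bound
    \<open>D\<close> is at most \<open>D / \<rho> * norm u\<close>, and by \<open>rec'\<close> each
    doubling undone halves both sides.\<close>
  have linear: "norm (\<theta>' u) \<le> D / \<rho> * norm u" if "2^n * norm u \<ge> \<rho>" for n u
    using that
  proof (induction n arbitrary: u)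
    case 0
    then have "D * \<rho> \<le> D * norm u" using D0 by (simp add: mult_left_mono)
    then have "D \<le> D / \<rho> * norm u" using \<rho> by (simp add: field_simps)
    then show ?case using D order_trans by blast
  next
    case (Suc n)
    show ?case
    proof (cases "norm u < \<rho>")
      case True
      have "norm (\<theta>' (2 *\<^sub>R u)) \<le> D / \<rho> * norm (2 *\<^sub>R u)"
        by (rule Suc.IH) (use Suc.prems in \<open>simp add: mult.commute mult.left_commute\<close>)
      then show ?thesis by (simp add: rec'[OF True] mult.commute mult.left_commute)
    next
      case False
      then have "D * \<rho> \<le> D * norm u" using D0 by (simp add: mult_left_mono)
      then have "D \<le> D / \<rho> * norm u" using \<rho> by (simp add: field_simps)
      then show ?thesis using D order_trans by blast
    qed
  qed
  \<comment> \<open>No number of doublings moves 0 away from the origin, so this point needs its own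
    argument.\<close>
  have zero': "\<theta>' 0 = 0"
  proof -
    have "\<theta>' 0 = (1/2) *\<^sub>R \<theta>' 0" using rec'[of 0] \<rho> by simp
    then have "norm (\<theta>' 0) = norm (\<theta>' 0) / 2" by (metis norm_scaleR abs_of_pos half_gt_zero_iff less_numeral_extra(1)
          mult.commute times_divide_eq_right mult.right_neutral)
    then show ?thesis by simp
  qed
  have scale: "\<exists>n. 2^n * norm u \<ge> c" if "u \<noteq> 0" for u :: 'x and c :: real
  proof -
    obtain n where "c / norm u < 2^n" using real_arch_pow[of 2 "c / norm u"] by auto
    then show ?thesis using that by (intro exI[of _ n]) (simp add: field_simps less_imp_le)
  qed
  have far\<theta>: "\<theta> u \<ge> 1" if "norm u \<ge> 1" for u
    using rec[of u] far[OF that] \<theta>_nonneg[of "2 *\<^sub>R u"] by simp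
  have ge: "\<theta> u \<ge> \<theta> (2 *\<^sub>R u) / 4" for u using rec[of u] nonneg[of u] by simp
  \<comment> \<open>The factor 1/4 is lost only once, in the shell between radius 1/2 and 1, where
    \<open>\<theta> (2 *\<^sub>R u) \<ge> 1\<close> is all that is known. Below radius 1/2 the
    quadratic bound is inherited exactly from \<open>2 *\<^sub>R u\<close>.\<close>
  have low: "min 1 ((norm u)\<^sup>2) / 4 \<le> \<theta> u" if "2^n * norm u \<ge> 1" for n u
    using that
  proof (induction n arbitrary: u)
    case 0
    then show ?case using far\<theta>[of u] by auto
  next
    case (Suc n)
    consider "norm u \<ge> 1" | "norm u < 1" "2 * norm u \<ge> 1" | "2 * norm u < 1" by linarith
    then show ?case
    proof cases
      case 1
      then show ?thesis using far\<theta>[of u] by auto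
    next
      case 2
      then have "\<theta> (2 *\<^sub>R u) \<ge> 1" by (intro far\<theta>) simp
      then have "1/4 \<le> \<theta> u" using ge[of u] by simp
      then show ?thesis by auto
    next
      case 3
      have "min 1 ((norm (2 *\<^sub>R u))\<^sup>2) / 4 \<le> \<theta> (2 *\<^sub>R u)"
        by (rule Suc.IH) (use Suc.prems in \<open>simp add: mult.commute mult.left_commute\<close>)
      moreover have "(norm (2 *\<^sub>R u))\<^sup>2 \<le> 1" using 3 by (intro power_le_one) auto
      ultimately have "(norm u)\<^sup>2 \<le> \<theta> (2 *\<^sub>R u)" by (simp add: power_mult_distrib)
      then have "(norm u)\<^sup>2 / 4 \<le> \<theta> u" using ge[of u] by simp
      then show ?thesis by auto
    qed
  qed
  define C where "C = D + D / \<rho> + (\<Sum>k. B * (1/4::real)^k) + 1"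
  have SB: "0 \<le> (\<Sum>k. B * (1/4::real)^k)" by (rule suminf_nonneg[OF sB]) (use B in simp)
  have C: "D \<le> C" "D / \<rho> \<le> C" "(\<Sum>k. B * (1/4::real)^k) \<le> C" "0 < C"
    using D0 \<rho> SB by (auto simp: C_def add_nonneg_nonneg add_nonneg_pos)
  have "smooth_gauge \<theta> \<theta>' C"
  proof
    fix u
    show "(\<theta> has_derivative blinfun_apply (\<theta>' u)) (at u)" "continuous_on UNIV \<theta>'"
      using series by auto
    show "\<theta> 0 = 0" using rec[of 0] near[of 0] \<rho> by simp
    show "min 1 ((norm u)\<^sup>2) / 4 \<le> \<theta> u"
      using low scale[of u 1] \<theta>_nonneg[of u] by (cases "u = 0") auto
    have "\<theta> u \<le> (\<Sum>k. B * (1/4)^k)"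
      unfolding \<theta>_def by (rule suminf_le[OF f0(2) sf sB])
    then show "\<theta> u \<le> C" using C by linarith
    show "norm (\<theta>' u) \<le> C" using D[of u] C by linarith
    have "norm (\<theta>' u) \<le> D / \<rho> * norm u"
      using linear scale[of u \<rho>] zero' by (cases "u = 0") auto
    also have "\<dots> \<le> C * norm u" using C(2) by (rule mult_right_mono) simp
    finally show "norm (\<theta>' u) \<le> C * norm u" .
  qed (rule C)
  then show ?thesis by blast
qed

text \<open>With \<open>c = b v0\<close> nonzero, the affine normalisation
  \<open>s u = 1 - 2 * (b (v0 + R *\<^sub>R u) / c)\<close> equals -1 at 0 and 1 wherever the
  translated and rescaled bump vanishes. Its squared positive part is therefore 0 near the origin
  and 1 far away, whatever the sign of \<open>b\<close>.\<close>

lemma bump_cutoff: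
  fixes b :: "'x::banach \<Rightarrow> real"
  assumes "C1_Lipschitz_bump b"
  shows "\<exists>\<beta> \<beta>' B L \<rho>. (\<forall>u. (\<beta> has_derivative blinfun_apply (\<beta>' u)) (at u)) \<and>
    continuous_on UNIV (\<beta>' :: 'x \<Rightarrow> 'x \<Rightarrow>\<^sub>L real) \<and> (\<forall>u. 0 \<le> \<beta> u) \<and> (\<forall>u. \<beta> u \<le> B) \<and>
    (\<forall>u. norm (\<beta>' u) \<le> L) \<and> 0 < (\<rho>::real) \<and> (\<forall>u. norm u < \<rho> \<longrightarrow> \<beta> u = 0) \<and>
    (\<forall>u. norm u \<ge> 1 \<longrightarrow> \<beta> u = 1)"
proof -
  obtain b' where b': "\<And>u. (b has_derivative blinfun_apply (b' u)) (at u)" "continuous_on UNIV b'"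
    using assms unfolding C1_Lipschitz_bump_def C1_on_def by auto
  obtain L where L: "L-lipschitz_on UNIV b"
    using assms unfolding C1_Lipschitz_bump_def by auto
  have L0: "0 \<le> L" using L by (rule lipschitz_on_nonneg)
  have lip: "\<bar>b u - b v\<bar> \<le> L * norm (u - v)" for u v
    using lipschitz_onD[OF L, of u v] by (simp add: dist_norm dist_real_def)
  have nb': "norm (b' u) \<le> L" for u
    by (rule norm_derivative_le_lipschitz[OF b'(1) L])
  have ne: "closure {v. b v \<noteq> 0} \<noteq> {}" and bounded: "bounded {v. b v \<noteq> 0}"
    using assms bounded_subset[OF _ closure_subset] unfolding C1_Lipschitz_bump_def by blast+
  obtain v0 where v0: "b v0 \<noteq> 0" using ne by auto
  obtain M where M: "\<And>v. b v \<noteq> 0 \<Longrightarrow> norm v \<le> M" using bounded by (auto simp: bounded_iff)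
  \<comment> \<open>\<open>M\<close> bounds the support, so for \<open>norm u \<ge> 1\<close> the
    point \<open>v0 + R *\<^sub>R u\<close> has norm greater than \<open>M\<close> and lies outside
    it.\<close>
  define R where "R = M + norm v0 + 1"
  have "0 \<le> M" using M[OF v0] norm_ge_zero order_trans by blast
  then have R: "R > 0" "R \<ge> 1" by (auto simp: R_def add_nonneg_pos)
  define c where "c = b v0"
  define s where "s u = 1 - 2 * (b (v0 + R *\<^sub>R u) / c)" for u
  define s' where "s' u = (- 2 * R / c) *\<^sub>R b' (v0 + R *\<^sub>R u)" for u
  have ds: "(s has_derivative blinfun_apply (s' u)) (at u)" for u
  proof -
    have "((\<lambda>u. v0 + R *\<^sub>R u) has_derivative (\<lambda>h. R *\<^sub>R h)) (at u)"
      by (auto intro!: derivative_eq_intros)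
    from diff_chain_at[OF this b'(1)]
    have "((\<lambda>u. b (v0 + R *\<^sub>R u)) has_derivative (\<lambda>h. b' (v0 + R *\<^sub>R u) (R *\<^sub>R h))) (at u)"
      by (simp add: o_def)
    then have "((\<lambda>u. 1 - (2 / c) * b (v0 + R *\<^sub>R u)) has_derivative
        (\<lambda>h. 0 - (2 / c) * b' (v0 + R *\<^sub>R u) (R *\<^sub>R h))) (at u)"
      by (intro has_derivative_diff has_derivative_const has_derivative_mult_right)
    moreover have "(\<lambda>u. 1 - (2 / c) * b (v0 + R *\<^sub>R u)) = s"
      by (simp add: fun_eq_iff s_def)
    moreover have "(\<lambda>h. 0 - (2 / c) * b' (v0 + R *\<^sub>R u) (R *\<^sub>R h)) = blinfun_apply (s' u)"
      by (simp add: fun_eq_iff s'_def blinfun.scaleR_left blinfun.scaleR_right blinfun.minus_left)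
    ultimately show ?thesis by simp
  qed
  have cs': "continuous_on UNIV s'"
    unfolding s'_def by (intro continuous_intros continuous_on_compose2[OF b'(2)]) auto
  have far: "s u = 1" if "norm u \<ge> 1" for u
  proof -
    have "R * 1 \<le> R * norm u" using that R by (intro mult_left_mono) auto
    moreover have "norm (R *\<^sub>R u) \<le> norm (v0 + R *\<^sub>R u) + norm v0"
      using norm_triangle_ineq4[of "v0 + R *\<^sub>R u" v0] by simp
    moreover have "norm (R *\<^sub>R u) = R * norm u" using R by simp
    moreover have "R = M + norm v0 + 1" by (rule R_def)
    ultimately have "norm (v0 + R *\<^sub>R u) > M" by linarith
    then have "b (v0 + R *\<^sub>R u) = 0" using M[of "v0 + R *\<^sub>R u"] by (cases "b (v0 + R *\<^sub>R u) = 0") auto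
    then show ?thesis by (simp add: s_def)
  qed
  define K where "K = 1 + 2 * (\<bar>b 0\<bar> + L * M) / \<bar>c\<bar>"
  have K: "\<bar>s u\<bar> \<le> K" for u
  proof -
    have "\<bar>b v\<bar> \<le> \<bar>b 0\<bar> + L * M" for v
    proof (cases "b v = 0")
      case False
      have "\<bar>b v\<bar> \<le> \<bar>b 0\<bar> + L * norm v" using lip[of v 0] by simp
      also have "\<dots> \<le> \<bar>b 0\<bar> + L * M" using M[OF False] L0 by (simp add: mult_left_mono)
      finally show ?thesis .
    qed (use L0 \<open>0 \<le> M\<close> in simp)
    then have "\<bar>b (v0 + R *\<^sub>R u)\<bar> / \<bar>c\<bar> \<le> (\<bar>b 0\<bar> + L * M) / \<bar>c\<bar>"
      by (intro divide_right_mono) auto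
    then have "\<bar>2 * (b (v0 + R *\<^sub>R u) / c)\<bar> \<le> 2 * (\<bar>b 0\<bar> + L * M) / \<bar>c\<bar>"
      by (simp add: abs_mult add_divide_distrib)
    then show ?thesis unfolding s_def K_def by linarith
  qed
  \<comment> \<open>On this radius the Lipschitz bound keeps \<open>b (v0 + R *\<^sub>R u)\<close>
    within half of \<open>\<bar>c\<bar>\<close> of \<open>c\<close>, so \<open>s\<close> has not yet
    become positive. The summand 1 protects the denominator when \<open>L\<close> is 0.\<close>
  define \<rho> where "\<rho> = \<bar>c\<bar> / (2 * (L * R + 1))"
  have LR: "L * R \<ge> 0" using L0 R by simp
  have c: "c \<noteq> 0" using v0 by (simp add: c_def)
  have \<rho>: "\<rho> > 0" using c LR by (simp add: \<rho>_def)
  have near: "s u \<le> 0" if "norm u < \<rho>" for u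
  proof -
    have "\<bar>b (v0 + R *\<^sub>R u) - c\<bar> \<le> L * R * norm u"
      using lip[of "v0 + R *\<^sub>R u" v0] R by (simp add: c_def)
    also have "\<dots> \<le> (L * R + 1) * \<rho>"
      using that LR by (intro mult_mono) auto
    also have "\<dots> = \<bar>c\<bar> / 2" using LR by (simp add: \<rho>_def field_simps)
    finally have "\<bar>(b (v0 + R *\<^sub>R u) - c) / c\<bar> \<le> 1 / 2"
      using c by (simp add: field_simps)
    then have "\<bar>b (v0 + R *\<^sub>R u) / c - 1\<bar> \<le> 1 / 2" using c by (simp add: diff_divide_distrib)
    then show ?thesis unfolding s_def by linarith
  qed
  define \<beta> where "\<beta> u = (max 0 (s u))\<^sup>2" for u
  define \<beta>' where "\<beta>' u = (2 * max 0 (s u)) *\<^sub>R s' u" for u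
  have d\<beta>: "(\<beta> has_derivative blinfun_apply (\<beta>' u)) (at u)" for u
  proof -
    have "((\<lambda>s::real. (max 0 s)\<^sup>2) has_derivative (*) (2 * max 0 (s u))) (at (s u))"
      using DERIV_max_0_power2[of "s u"] by (simp add: has_field_derivative_def)
    from diff_chain_at[OF ds this]
    have "(\<beta> has_derivative (\<lambda>h. 2 * max 0 (s u) * s' u h)) (at u)"
      by (simp add: o_def \<beta>_def[abs_def])
    then show ?thesis
      by (rule has_derivative_eq_rhs) (simp add: fun_eq_iff \<beta>'_def blinfun.scaleR_left)
  qed
  have contS: "continuous_on UNIV s"
    using ds by (meson continuous_at_imp_continuous_on has_derivative_continuous)
  have cont: "continuous_on UNIV \<beta>'"
    unfolding \<beta>'_def by (intro continuous_intros cs' contS)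
  have K0: "0 \<le> K" using K abs_ge_zero order_trans by blast
  have mK: "0 \<le> max 0 (s u)" "max 0 (s u) \<le> K" for u using K[of u] K0 by auto
  have up: "\<beta> u \<le> K\<^sup>2" for u
    unfolding \<beta>_def using mK by (intro power_mono) auto
  have "norm (\<beta>' u) \<le> (2 * K) * (2 * R / \<bar>c\<bar> * L)" for u
  proof -
    have "norm (s' u) \<le> 2 * R / \<bar>c\<bar> * L"
      using nb'[of "v0 + R *\<^sub>R u"] R by (auto simp: s'_def intro!: divide_right_mono mult_left_mono)
    then show ?thesis
      unfolding \<beta>'_def norm_scaleR using mK K0 by (intro mult_mono) auto
  qed
  moreover have "\<beta> u = 0" if "norm u < \<rho>" for u
    using near[OF that] by (simp add: \<beta>_def)
  moreover have "\<beta> u = 1" if "norm u \<ge> 1" for u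
    using far[OF that] by (simp add: \<beta>_def)
  ultimately show ?thesis
    using d\<beta> cont up \<rho>
    by (intro exI[of _ \<beta>] exI[of _ \<beta>'] exI[of _ "K\<^sup>2"] exI[of _ "(2 * K) * (2 * R / \<bar>c\<bar> * L)"] exI[of _ \<rho>])
       (auto simp: \<beta>_def)
qed

lemma bump_smooth_gauge:
  fixes b :: "'x::banach \<Rightarrow> real"
  assumes "C1_Lipschitz_bump b"
  shows "\<exists>\<theta> \<theta>' C. smooth_gauge (\<theta> :: 'x \<Rightarrow> real) \<theta>' C"
  using bump_cutoff[OF assms] by (elim exE conjE) (rule dyadic_gauge, blast+)


section \<open>A smooth variational principle\<close>

text \<open>Closed sublevel sets express lower semicontinuity of \<open>h\<close> on the closed set
  \<open>S\<close>. Along a convergent sequence the values of \<open>p\<close> converge, so up to an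
  arbitrary \<open>e\<close> the limit of \<open>p\<close> can be moved into the level.\<close>

lemma closed_sublevel_add_continuous:
  fixes h p :: "'a::metric_space \<Rightarrow> real"
  assumes S: "closed S" and h: "\<And>c. closed {x \<in> S. h x \<le> c}" and p: "continuous_on S p"
  shows "closed {x \<in> S. h x + p x \<le> c}"
  unfolding closed_sequential_limits
proof (intro allI impI, elim conjE)
  fix x l assume x: "\<forall>n. x n \<in> {x \<in> S. h x + p x \<le> c}" and l: "x \<longlonglongrightarrow> l"
  have lS: "l \<in> S" using S x l closed_sequentially by blast
  have pl: "(\<lambda>n. p (x n)) \<longlonglongrightarrow> p l"
    using continuous_on_tendsto_compose[OF p l lS] x by auto
  have "h l \<le> c - p l + e" if e: "e > 0" for e
  proof -
    have "\<forall>\<^sub>F n in sequentially. p l - e < p (x n)"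
      by (rule order_tendstoD(1)[OF pl]) (use e in simp)
    then have ev: "\<forall>\<^sub>F n in sequentially. x n \<in> {x \<in> S. h x \<le> c - p l + e}"
      by eventually_elim (use x in \<open>smt (verit) mem_Collect_eq\<close>)
    have "l \<in> {x \<in> S. h x \<le> c - p l + e}"
      by (rule Lim_in_closed_set[OF h ev _ l]) simp
    then show ?thesis by simp
  qed
  then have "h l \<le> c - p l" by (rule field_le_epsilon)
  then show "l \<in> {x \<in> S. h x + p x \<le> c}" using lS by simp
qed

text \<open>
  Borwein--Preiss: the sublevel sets of the successively perturbed functions shrink to one point.
\<close>

lemma smooth_variational_principle:
  fixes h :: "'a::complete_space \<Rightarrow> real" and \<rho> :: "'a \<Rightarrow> 'a \<Rightarrow> real"
  assumes S: "closed S" and x0: "x0 \<in> S"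
    and lsc: "\<And>c. closed {x \<in> S. h x \<le> c}" and below: "\<And>x. x \<in> S \<Longrightarrow> m \<le> h x"
    and \<rho>: "\<And>x y. 0 \<le> \<rho> x y" "\<And>x. \<rho> x x = 0" "\<And>x y. \<rho> x y \<le> C"
    and cont: "\<And>y. continuous_on S (\<lambda>x. \<rho> x y)"
    and small: "\<And>e. 0 < e \<Longrightarrow> \<exists>\<eta>>0. \<forall>x y. \<rho> x y \<le> \<eta> \<longrightarrow> dist x y < e"
    and \<delta>: "0 < \<delta>"
  obtains y p where "y \<in> S" "h y \<le> h x0"
    "\<And>x. x \<in> S \<Longrightarrow> h y + (\<Sum>k. \<delta> * (1/2)^k * \<rho> y (p k)) \<le> h x + (\<Sum>k. \<delta> * (1/2)^k * \<rho> x (p k))"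
proof -
  \<comment> \<open>The new function adds a penalty centred at the old point, and the new point
    nearly minimises it. The tolerance 4^-k is chosen against the penalty weight 2^-k: their
    quotient still tends to 0, which is what shrinks the sublevel sets.\<close>
  define step where "step k H p H' p' \<longleftrightarrow> H' = (\<lambda>x. H x + \<delta> * (1/2)^k * \<rho> x p) \<and> H' p' \<le> H' p \<and>
      (\<forall>z\<in>S. H' p' \<le> H' z + (1/4)^k)" for k :: nat and H H' :: "'a \<Rightarrow> real" and p p'
  have "\<exists>s. \<forall>k. (snd (s k) \<in> S \<and> (\<forall>x\<in>S. m \<le> fst (s k) x) \<and> (k = 0 \<longrightarrow> s k = (h, x0))) \<and>
      step k (fst (s k)) (snd (s k)) (fst (s (Suc k))) (snd (s (Suc k)))"
  proof (rule dependent_nat_choice)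
    show "\<exists>s. snd s \<in> S \<and> (\<forall>x\<in>S. m \<le> fst s x) \<and> (0 = (0::nat) \<longrightarrow> s = (h, x0))"
      using x0 below by (intro exI[of _ "(h, x0)"]) auto
  next
    fix s :: "('a \<Rightarrow> real) \<times> 'a" and k :: nat
    assume s: "snd s \<in> S \<and> (\<forall>x\<in>S. m \<le> fst s x) \<and> (k = 0 \<longrightarrow> s = (h, x0))"
    define H where "H x = fst s x + \<delta> * (1/2)^k * \<rho> x (snd s)" for x
    have H: "m \<le> H x" if "x \<in> S" for x
      using s that \<rho>(1)[of x "snd s"] \<delta> by (auto simp: H_def intro: add_increasing2)
    then have bdd: "bdd_below (H ` S)" by (rule bdd_belowI2)
    \<comment> \<open>If the current centre is already a good enough near-minimiser it is kept;
      otherwise any near-minimiser lies strictly below it.\<close>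
    have "\<exists>z\<in>S. H z \<le> H (snd s) \<and> H z \<le> Inf (H ` S) + (1/4)^k"
    proof (cases "H (snd s) \<le> Inf (H ` S) + (1/4)^k")
      case False
      have "Inf (H ` S) < Inf (H ` S) + (1/4)^k" by simp
      then obtain z where "z \<in> S" "H z < Inf (H ` S) + (1/4)^k"
        using cInf_lessD[of "H ` S"] s by blast
      with False show ?thesis by (intro bexI[of _ z]) auto
    qed (use s in auto)
    then obtain z where z: "z \<in> S" "H z \<le> H (snd s)" "H z \<le> Inf (H ` S) + (1/4)^k" by blast
    have "H z \<le> H w + (1/4)^k" if "w \<in> S" for w
      using z(3) cInf_lower[OF _ bdd, of "H w"] that by auto
    with z H show "\<exists>s'. (snd s' \<in> S \<and> (\<forall>x\<in>S. m \<le> fst s' x) \<and> (Suc k = 0 \<longrightarrow> s' = (h, x0))) \<and>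
        step k (fst s) (snd s) (fst s') (snd s')"
      by (intro exI[of _ "(H, z)"]) (auto simp: step_def H_def[abs_def])
  qed
  then obtain s where s: "\<And>k. snd (s k) \<in> S" "\<And>k x. x \<in> S \<Longrightarrow> m \<le> fst (s k) x" "s 0 = (h, x0)"
      "\<And>k. step k (fst (s k)) (snd (s k)) (fst (s (Suc k))) (snd (s (Suc k)))"
    by blast
  define H where "H k = fst (s k)" for k
  define p where "p k = snd (s k)" for k
  have pS: "p k \<in> S" for k using s by (simp add: p_def)
  have H0: "H 0 = h" "p 0 = x0" using s(3) by (auto simp: H_def p_def)
  have HSuc: "H (Suc k) x = H k x + \<delta> * (1/2)^k * \<rho> x (p k)" for k x
    using s(4)[of k] by (simp add: step_def H_def p_def)
  have mono_p: "H (Suc k) (p (Suc k)) \<le> H (Suc k) (p k)" for k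
    using s(4)[of k] unfolding step_def H_def p_def by blast
  have near: "H (Suc k) (p (Suc k)) \<le> H (Suc k) z + (1/4)^k" if "z \<in> S" for k z
    using s(4)[of k] that unfolding step_def H_def p_def by blast
  have at_p: "H (Suc k) (p k) = H k (p k)" for k using HSuc \<rho> by simp
  have H_mono: "H k x \<le> H (Suc k) x" for k x using HSuc \<rho>(1) \<delta> by simp
  have H_closed: "closed {x \<in> S. H k x \<le> c}" for k c
  proof (induction k arbitrary: c)
    case 0
    then show ?case using lsc H0 by simp
  next
    case (Suc k)
    show ?case unfolding HSuc
      by (rule closed_sublevel_add_continuous[OF S Suc.IH]) (intro continuous_intros cont)
  qed
  \<comment> \<open>The level is also \<open>H k (p k)\<close>, because the newest penalty vanishes
    at its own centre. The sets decrease since \<open>H\<close> grows with k and the next centre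
    does not exceed the level.\<close>
  define T where "T k = {x \<in> S. H (Suc k) x \<le> H (Suc k) (p k)}" for k
  have T_closed: "closed (T k)" for k unfolding T_def by (rule H_closed)
  have T_dec: "T (Suc k) \<subseteq> T k" for k
    unfolding T_def using H_mono[of "Suc k"] at_p[of "Suc k"] mono_p[of k]
    by (auto intro: order_trans dest: order_trans[OF H_mono])
  have T_anti: "T j \<subseteq> T k" if "k \<le> j" for j k
    using lift_Suc_antimono_le[of T, OF T_dec that] .
  have pT: "p j \<in> T k" if "k \<le> j" for j k
    using T_anti[OF that] pS[of j] by (auto simp: T_def)
  \<comment> \<open>A point of \<open>T (Suc k)\<close> pays the penalty around
    \<open>p (Suc k)\<close> and still does not exceed the value there, but near-minimality allows a
    gain of at most 4^-k. Dividing by the penalty weight leaves a multiple of 2^-k.\<close>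
  have small_T: "\<rho> x (p (Suc k)) \<le> 2 / \<delta> * (1/2)^k" if "x \<in> T (Suc k)" for x k
  proof -
    have "H (Suc k) x + \<delta> * (1/2)^Suc k * \<rho> x (p (Suc k)) \<le> H (Suc k) (p (Suc k))"
      using that at_p[of "Suc k"] HSuc[of "Suc k" x] by (auto simp: T_def)
    also have "\<dots> \<le> H (Suc k) x + (1/4)^k" using that by (intro near) (simp add: T_def)
    finally have "\<delta> * (1/2)^Suc k * \<rho> x (p (Suc k)) \<le> (1/2)^k * (1/2)^k"
      by (simp flip: power_mult_distrib)
    then have "(1/2)^k * (\<delta> * \<rho> x (p (Suc k)) / 2) \<le> (1/2)^k * (1/2)^k" by (simp add: field_simps)
    then have "\<delta> * \<rho> x (p (Suc k)) / 2 \<le> (1/2)^k" by simp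
    then show ?thesis using \<delta> by (simp add: field_simps)
  qed
  have "Cauchy p"
    unfolding Cauchy_altdef2
  proof (intro allI impI)
    fix e :: real assume "0 < e"
    then obtain \<eta> where \<eta>: "\<eta> > 0" "\<And>x y. \<rho> x y \<le> \<eta> \<Longrightarrow> dist x y < e" using small by blast
    have "(\<lambda>k. 2 / \<delta> * (1/2)^k) \<longlonglongrightarrow> 2 / \<delta> * 0"
      by (intro tendsto_intros LIMSEQ_power_zero) auto
    then have "\<forall>\<^sub>F k in sequentially. 2 / \<delta> * (1/2)^k < \<eta>"
      by (rule order_tendstoD) (use \<eta> in simp)
    then obtain k where k: "2 / \<delta> * (1/2)^k < \<eta>" by (auto simp: eventually_sequentially)
    have "dist (p n) (p (Suc k)) < e" if "Suc k \<le> n" for n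
      using \<eta>(2) small_T[OF pT[OF that]] k by (meson less_imp_le order_trans)
    then show "\<exists>K. \<forall>n\<ge>K. dist (p n) (p K) < e" by blast
  qed
  then obtain y where y: "p \<longlonglongrightarrow> y" using Cauchy_convergent_iff convergent_def by blast
  have yT: "y \<in> T k" for k
    by (rule Lim_in_closed_set[OF T_closed _ _ y])
       (auto simp: eventually_sequentially intro!: exI[of _ k] pT)
  have yS: "y \<in> S" using yT[of 0] by (simp add: T_def)
  have H_lim: "(\<lambda>k. H k x) \<longlonglongrightarrow> h x + (\<Sum>k. \<delta> * (1/2)^k * \<rho> x (p k))" for x
  proof -
    have "summable (\<lambda>k. \<delta> * (1/2)^k * C)"
      by (intro summable_mult summable_mult2 summable_geometric) auto
    then have "summable (\<lambda>k. \<delta> * (1/2)^k * \<rho> x (p k))"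
      by (rule summable_comparison_test[rotated])
         (use \<rho> \<delta> in \<open>auto intro!: exI[of _ 0] mult_left_mono simp: abs_mult\<close>)
    moreover have "H k x = h x + (\<Sum>i<k. \<delta> * (1/2)^i * \<rho> x (p i))" for k
      by (induction k) (auto simp: H0 HSuc)
    ultimately show ?thesis by (auto intro!: tendsto_intros summable_LIMSEQ)
  qed
  show ?thesis
  proof
    show "y \<in> S" by (rule yS)
    \<comment> \<open>This comparison of the unperturbed values comes from \<open>y\<close> lying in
      \<open>T 0\<close>. It later lets the penalty be estimated without any perturbation
      term.\<close>
    show "h y \<le> h x0" using H_mono[of 0 y] yT[of 0] at_p[of 0] by (auto simp: T_def H0)
    fix x assume x: "x \<in> S"
    \<comment> \<open>The indices on the two sides differ by one; this is harmless because both
      sequences converge to the fully perturbed values.\<close>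
    have "H (Suc (Suc k)) y \<le> H (Suc k) x + (1/4)^k" for k
      using yT[of "Suc k"] at_p[of "Suc k"] near[OF x, of k] by (auto simp: T_def)
    moreover have "(\<lambda>k. H (Suc k) x + (1/4)^k) \<longlonglongrightarrow> h x + (\<Sum>k. \<delta> * (1/2)^k * \<rho> x (p k)) + 0"
      by (intro tendsto_add LIMSEQ_Suc[OF H_lim] LIMSEQ_power_zero) auto
    ultimately show "h y + (\<Sum>k. \<delta> * (1/2)^k * \<rho> y (p k)) \<le> h x + (\<Sum>k. \<delta> * (1/2)^k * \<rho> x (p k))"
      using LIMSEQ_le[OF LIMSEQ_Suc[OF LIMSEQ_Suc[OF H_lim]]] by fastforce
  qed
qed


section \<open>The fuzzy sum rule in the model space\<close>

context smooth_gauge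
begin

lemma nonneg: "0 \<le> \<theta> u"
proof -
  have "0 \<le> min 1 ((norm u)\<^sup>2) / 4" by simp
  then show ?thesis using lower[of u] by linarith
qed

text \<open>Inverts \<open>lower\<close>. That bound never exceeds 1/4, hence the truncation
  \<open>min 1 e\<close>; dividing by 8 instead of 4 makes the resulting inequality strict.\<close>

lemma small:
  assumes "0 < e"
  shows "\<exists>\<eta>>0. \<forall>u. \<theta> u \<le> \<eta> \<longrightarrow> norm u < e"
proof (intro exI[of _ "(min 1 e)\<^sup>2 / 8"] conjI allI impI)
  show "0 < (min 1 e)\<^sup>2 / 8" using assms by simp
  fix u assume "\<theta> u \<le> (min 1 e)\<^sup>2 / 8"
  then have "min 1 ((norm u)\<^sup>2) \<le> (min 1 e)\<^sup>2 / 2" using lower[of u] by linarith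
  also have "\<dots> < (min 1 e)\<^sup>2" using assms by simp
  finally have *: "min 1 ((norm u)\<^sup>2) < (min 1 e)\<^sup>2" .
  have "(min 1 e)\<^sup>2 \<le> 1" using assms by (intro power_le_one) auto
  with * have "(norm u)\<^sup>2 < (min 1 e)\<^sup>2" by linarith
  then have "norm u < min 1 e" by (rule power2_less_imp_less) (use assms in simp)
  then show "norm u < e" by simp
qed

lemma tendsto_zeroI:
  assumes "(\<lambda>n. \<theta> (u n)) \<longlonglongrightarrow> 0"
  shows "u \<longlonglongrightarrow> 0"
proof (rule tendstoI)
  fix e :: real assume "0 < e"
  then obtain \<eta> where \<eta>: "\<eta> > 0" "\<And>u. \<theta> u \<le> \<eta> \<Longrightarrow> norm u < e" using small by blast
  have "\<forall>\<^sub>F n in sequentially. \<theta> (u n) < \<eta>" using order_tendstoD(2)[OF assms] \<eta> by blast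
  then show "\<forall>\<^sub>F n in sequentially. dist (u n) 0 < e"
    by eventually_elim (use \<eta> in auto)
qed

lemma continuous_on_gauge: "continuous_on S \<theta>"
  using deriv by (meson continuous_at_imp_continuous_on has_derivative_continuous)

lemma deriv_shift: "((\<lambda>w. \<theta> (w - v)) has_derivative blinfun_apply (\<theta>' (w - v))) (at w)"
proof -
  have "((\<lambda>w. w - v) has_derivative (\<lambda>h. h)) (at w)"
    by (auto intro!: derivative_eq_intros)
  from diff_chain_at[OF this deriv] show ?thesis by (simp add: o_def)
qed

lemma cont_deriv_shift: "continuous_on S (\<lambda>w. \<theta>' (w - v))"
  by (intro continuous_on_compose2[OF cont_deriv] continuous_intros) auto

lemma deriv_reflect: "((\<lambda>w. \<theta> (v - w)) has_derivative blinfun_apply (- \<theta>' (v - w))) (at w)"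
proof -
  have "((\<lambda>w. v - w) has_derivative (\<lambda>h. - h)) (at w)"
    by (auto intro!: derivative_eq_intros)
  from diff_chain_at[OF this deriv]
  have "((\<lambda>w. \<theta> (v - w)) has_derivative (\<lambda>h. \<theta>' (v - w) (- h))) (at w)" by (simp add: o_def)
  then show ?thesis
    by (rule has_derivative_eq_rhs) (simp add: fun_eq_iff blinfun.minus_left blinfun.minus_right)
qed

lemma cont_deriv_reflect: "continuous_on S (\<lambda>w. \<theta>' (v - w))"
  by (intro continuous_on_compose2[OF cont_deriv] continuous_intros) auto

text \<open>The form in which the variational principle delivers its perturbation, for one
  coordinate and with the gauge of the difference as distance; \<open>p k\<close> are the successive
  centres.\<close>

definition perturbation :: "real \<Rightarrow> (nat \<Rightarrow> 'x) \<Rightarrow> 'x \<Rightarrow> real" where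
  "perturbation \<delta> p w = (\<Sum>k. \<delta> * (1/2)^k * \<theta> (w - p k))"

definition perturbation_deriv :: "real \<Rightarrow> (nat \<Rightarrow> 'x) \<Rightarrow> 'x \<Rightarrow> 'x \<Rightarrow>\<^sub>L real" where
  "perturbation_deriv \<delta> p w = (\<Sum>k. (\<delta> * (1/2)^k) *\<^sub>R \<theta>' (w - p k))"

lemma summable_perturbation:
  assumes "0 < \<delta>"
  shows "summable (\<lambda>k. \<delta> * (1/2)^k * \<theta> (w - p k))"
proof (rule summable_comparison_test)
  show "summable (\<lambda>k. \<delta> * (1/2)^k * C)"
    by (intro summable_mult summable_mult2 summable_geometric) auto
  show "\<exists>N. \<forall>k\<ge>N. norm (\<delta> * (1/2)^k * \<theta> (w - p k)) \<le> \<delta> * (1/2)^k * C"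
    using assms nonneg upper by (auto simp: abs_mult intro!: mult_left_mono)
qed

lemma perturbation:
  assumes \<delta>: "0 < \<delta>"
  shows "(perturbation \<delta> p has_derivative blinfun_apply (perturbation_deriv \<delta> p w)) (at w)"
    and "continuous_on UNIV (perturbation_deriv \<delta> p)"
    and "norm (perturbation_deriv \<delta> p w) \<le> 2 * \<delta> * C"
proof -
  have 1: "((\<lambda>w. \<delta> * (1/2)^k * \<theta> (w - p k)) has_derivative
      blinfun_apply ((\<delta> * (1/2)^k) *\<^sub>R \<theta>' (w - p k))) (at w)" for k w
    using has_derivative_mult_right[OF deriv_shift, of "\<delta> * (1/2)^k"]
    by (rule has_derivative_eq_rhs) (simp add: fun_eq_iff blinfun.scaleR_left)
  have 2: "continuous_on UNIV (\<lambda>w. (\<delta> * (1/2)^k) *\<^sub>R \<theta>' (w - p k))" for k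
    by (intro continuous_intros cont_deriv_shift)
  have 3: "norm ((\<delta> * (1/2)^k) *\<^sub>R \<theta>' (w - p k)) \<le> (\<delta> * C) * (1/2)^k" for k w
    using \<delta> deriv_bound[of "w - p k"] by (simp add: field_simps)
  have 4: "(\<lambda>k. (\<delta> * C) * (1/2)^k) sums ((\<delta> * C) * (1 / (1 - 1/2)))"
    by (intro sums_mult geometric_sums) auto
  note series = has_derivative_suminf[OF 1 2 3 sums_summable[OF 4] summable_perturbation[OF \<delta>]]
  show "(perturbation \<delta> p has_derivative blinfun_apply (perturbation_deriv \<delta> p w)) (at w)"
    "continuous_on UNIV (perturbation_deriv \<delta> p)"
    using series(1,2) unfolding perturbation_def[abs_def] perturbation_deriv_def[abs_def] by auto
  show "norm (perturbation_deriv \<delta> p w) \<le> 2 * \<delta> * C"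
    using series(3)[of w] sums_unique[OF 4] by (simp add: perturbation_deriv_def mult.commute)
qed

text \<open>
  Doubling of variables: \<open>t * \<theta> (y - z)\<close> is the penalty and \<open>\<delta> * \<theta> (y - a)\<close> localises at \<open>a\<close>.
\<close>

lemma doubled_minimum:
  fixes F G H :: "'x \<Rightarrow> real"
  assumes r: "0 < r" and \<delta>: "0 < \<delta>" and t: "0 \<le> t"
    and lsc: "\<And>c. closed {y \<in> cball a r. F y \<le> c}"
    and G: "continuous_on (cball a r) G" and H: "continuous_on (cball a r) H"
    and G1: "\<And>y. y \<in> cball a r \<Longrightarrow> \<bar>G y - G a\<bar> \<le> 1"
    and min: "\<And>y. y \<in> cball a r \<Longrightarrow> F a + G a - H a \<le> F y + G y - H y"
  shows "\<exists>y z p q. y \<in> cball a r \<and> z \<in> cball a r \<and>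
    F y - H y + G z + t * \<theta> (y - z) + \<delta> * \<theta> (y - a) \<le> F a - H a + G a \<and>
    (\<forall>v\<in>cball a r. \<forall>w\<in>cball a r.
       F y - H y + G z + t * \<theta> (y - z) + \<delta> * \<theta> (y - a) + perturbation \<delta> p y + perturbation \<delta> q z \<le>
       F v - H v + G w + t * \<theta> (v - w) + \<delta> * \<theta> (v - a) + perturbation \<delta> p v + perturbation \<delta> q w)"
proof -
  define B where "B = cball a r \<times> cball a r"
  define h where "h = (\<lambda>(y, z). F y + (G z - H y + t * \<theta> (y - z) + \<delta> * \<theta> (y - a)))"
  \<comment> \<open>A sum over the coordinates, so that the resulting series splits into a function
    of the first variable and a function of the second (\<open>split\<close> below).\<close>
  define \<rho> where "\<rho> = (\<lambda>(y, z) (y', z'). \<theta> (y - y') + \<theta> (z - z'))"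
  have B: "closed B" unfolding B_def by (intro closed_Times closed_cball)
  have a: "(a, a) \<in> B" using r by (simp add: B_def)
  have F_closed: "closed {x \<in> B. F (fst x) \<le> c}" for c
  proof -
    have "{x \<in> B. F (fst x) \<le> c} = {y \<in> cball a r. F y \<le> c} \<times> cball a r"
      by (auto simp: B_def)
    then show ?thesis using lsc by (simp add: closed_Times)
  qed
  have cont: "continuous_on B (\<lambda>x. G (snd x) - H (fst x) + t * \<theta> (fst x - snd x) + \<delta> * \<theta> (fst x - a))"
    by (intro continuous_intros continuous_on_compose2[OF G] continuous_on_compose2[OF H]
        continuous_on_compose2[OF continuous_on_gauge[of UNIV]]) (auto simp: B_def)
  obtain x s where x: "x \<in> B" "h x \<le> h (a, a)" and
    s: "\<And>x'. x' \<in> B \<Longrightarrow> h x + (\<Sum>k. \<delta> * (1/2)^k * \<rho> x (s k)) \<le> h x' + (\<Sum>k. \<delta> * (1/2)^k * \<rho> x' (s k))"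
  proof (rule smooth_variational_principle[OF B a _ _ _ _ _ _ _ \<delta>, of h "F a + G a - H a - 2" \<rho> "2 * C"])
    show "closed {x \<in> B. h x \<le> c}" for c
      using closed_sublevel_add_continuous[OF B F_closed cont] by (simp add: h_def case_prod_beta)
    \<comment> \<open>Replacing \<open>G z\<close> by \<open>G y\<close> costs at most 2, since both
      are within 1 of \<open>G a\<close>; then \<open>min\<close> applies.\<close>
    show "F a + G a - H a - 2 \<le> h x" if "x \<in> B" for x
    proof -
      obtain y z where [simp]: "x = (y, z)" by (cases x)
      have yz: "y \<in> cball a r" "z \<in> cball a r" using that by (auto simp: B_def)
      have "0 \<le> t * \<theta> (y - z)" "0 \<le> \<delta> * \<theta> (y - a)" using t \<delta> nonneg by auto
      then show ?thesis using min[OF yz(1)] G1[OF yz(1)] G1[OF yz(2)] unfolding h_def by simp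
    qed
    show "0 \<le> \<rho> x y" for x y using nonneg by (auto simp: \<rho>_def case_prod_beta)
    show "\<rho> x x = 0" for x using zero by (auto simp: \<rho>_def case_prod_beta)
    show "\<rho> x y \<le> 2 * C" for x y
      using upper[of "fst x - fst y"] upper[of "snd x - snd y"] by (simp add: \<rho>_def case_prod_beta)
    show "continuous_on B (\<lambda>x. \<rho> x y)" for y
      unfolding \<rho>_def case_prod_beta
      by (intro continuous_intros continuous_on_compose2[OF continuous_on_gauge[of UNIV]]) auto
    show "\<exists>\<eta>>0. \<forall>x y. \<rho> x y \<le> \<eta> \<longrightarrow> dist x y < e" if "0 < e" for e
    proof -
      have "0 < e / 2" using that by simp
      then obtain \<eta> where \<eta>: "\<eta> > 0" "\<And>u. \<theta> u \<le> \<eta> \<Longrightarrow> norm u < e / 2"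
        using small by blast
      have "dist x y < e" if "\<rho> x y \<le> \<eta>" for x y
      proof -
        have "\<theta> (fst x - fst y) \<le> \<eta>" "\<theta> (snd x - snd y) \<le> \<eta>"
          using that nonneg[of "fst x - fst y"] nonneg[of "snd x - snd y"]
          by (auto simp: \<rho>_def case_prod_beta)
        then have "dist (fst x) (fst y) < e / 2" "dist (snd x) (snd y) < e / 2"
          using \<eta>(2) by (auto simp: dist_norm)
        moreover have "dist x y \<le> dist (fst x) (fst y) + dist (snd x) (snd y)"
          unfolding dist_prod_def by (rule sqrt_sum_squares_le_sum) auto
        ultimately show ?thesis by linarith
      qed
      with \<eta> show ?thesis by blast
    qed
  qed blast
  have split: "(\<Sum>k. \<delta> * (1/2)^k * \<rho> (v, w) (s k)) =
      perturbation \<delta> (fst \<circ> s) v + perturbation \<delta> (snd \<circ> s) w" for v w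
    unfolding perturbation_def suminf_add[OF summable_perturbation[OF \<delta>] summable_perturbation[OF \<delta>]]
    by (simp add: \<rho>_def case_prod_beta distrib_left)
  obtain y z where [simp]: "x = (y, z)" by (cases x)
  show ?thesis
  proof (rule exI[of _ y], rule exI[of _ z], rule exI[of _ "fst \<circ> s"], rule exI[of _ "snd \<circ> s"], intro conjI ballI)
    show "y \<in> cball a r" "z \<in> cball a r" using x(1) by (auto simp: B_def)
    show "F y - H y + G z + t * \<theta> (y - z) + \<delta> * \<theta> (y - a) \<le> F a - H a + G a"
      using x(2) zero by (simp add: h_def)
    fix v w assume "v \<in> cball a r" "w \<in> cball a r"
    then have "(v, w) \<in> B" by (simp add: B_def)
    from s[OF this]
    show "F y - H y + G z + t * \<theta> (y - z) + \<delta> * \<theta> (y - a) +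
        perturbation \<delta> (fst \<circ> s) y + perturbation \<delta> (snd \<circ> s) z \<le>
       F v - H v + G w + t * \<theta> (v - w) + \<delta> * \<theta> (v - a) +
        perturbation \<delta> (fst \<circ> s) v + perturbation \<delta> (snd \<circ> s) w"
      by (simp add: h_def split)
  qed
qed

text \<open>A minimum of the doubled function is minimal in each variable separately. Freezing one
  variable yields the test functions \<open>S\<close> for \<open>F\<close> and \<open>T\<close> for
  \<open>G\<close>; the derivative of the penalty enters \<open>P\<close> and \<open>Q\<close> with
  opposite signs and cancels in \<open>P + Q\<close>.\<close>

lemma fuzzy_sum_rule:
  fixes F G H :: "'x \<Rightarrow> real"
  assumes r: "0 < r" and \<epsilon>: "0 < \<epsilon>"
    and lsc: "\<And>c. closed {y \<in> cball a r. F y \<le> c}"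
    and G: "uniformly_continuous_on (cball a r) G" and H: "C1_on (cball a r) H"
    and H': "(H has_derivative blinfun_apply D) (at a)"
    and G_near: "\<forall>y\<in>cball a r. \<bar>G y - G a\<bar> \<le> 1"
    and local_min: "\<forall>y\<in>cball a r. F a + G a - H a \<le> F y + G y - H y"
  shows "\<exists>y z S T P Q. y \<in> ball a r \<and> z \<in> ball a r \<and> norm (y - a) < \<epsilon> \<and> norm (z - a) < \<epsilon> \<and>
    \<bar>F y - F a\<bar> < \<epsilon> \<and> \<bar>G z - G a\<bar> < \<epsilon> \<and>
    C1_on (cball a r) S \<and> (S has_derivative blinfun_apply P) (at y) \<and>
    (\<forall>w\<in>cball a r. F y - S y \<le> F w - S w) \<and>
    C1_on (cball a r) T \<and> (T has_derivative blinfun_apply Q) (at z) \<and>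
    (\<forall>w\<in>cball a r. G z - T z \<le> G w - T w) \<and>
    norm (P + Q - D) < \<epsilon> \<and> norm (y - z) * max (norm P) (norm Q) < \<epsilon>"
proof -
  note G1 = bspec[OF G_near] and min = bspec[OF local_min]
  define B where "B = cball a r"
  \<comment> \<open>The localising term costs \<delta> C = \<epsilon>/12 in the derivative and each
    of the two perturbations 2 \<delta> C = \<epsilon>/6. The total 5/12 \<epsilon> leaves
    \<epsilon>/2 for the variation of the derivative of \<open>H\<close>.\<close>
  define \<delta> where "\<delta> = \<epsilon> / (12 * C)"
  have \<delta>: "0 < \<delta>" using \<epsilon> C_pos by (simp add: \<delta>_def)
  have \<delta>C: "\<delta> * C = \<epsilon> / 12" using C_pos by (simp add: \<delta>_def)
  obtain H1 where H1: "\<And>w. w \<in> B \<Longrightarrow> (H has_derivative blinfun_apply (H1 w)) (at w)"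
      "continuous_on B H1"
    using H unfolding C1_on_def B_def by blast
  have aB: "a \<in> B" "a \<in> interior B" using r ball_subset_cball by (auto simp: B_def mem_interior)
  have D: "H1 a = D"
    using has_derivative_unique[OF H1(1)[OF aB(1)] H'] by (simp add: blinfun_apply_inject)
  have H1_cont: "isCont H1 a" using H1(2) aB(2) by (rule continuous_on_interior)
  have H_cont: "isCont H a" using H' by (rule has_derivative_continuous)
  have G_cont_B: "continuous_on B G" using G unfolding B_def by (rule uniformly_continuous_imp_continuous)
  have G_cont: "isCont G a" using G_cont_B aB(2) by (rule continuous_on_interior)
  define sol where "sol n y z p q \<longleftrightarrow> y \<in> B \<and> z \<in> B \<and>
    F y - H y + G z + real n * \<theta> (y - z) + \<delta> * \<theta> (y - a) \<le> F a - H a + G a \<and>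
    (\<forall>v\<in>B. \<forall>w\<in>B.
       F y - H y + G z + real n * \<theta> (y - z) + \<delta> * \<theta> (y - a) + perturbation \<delta> p y + perturbation \<delta> q z \<le>
       F v - H v + G w + real n * \<theta> (v - w) + \<delta> * \<theta> (v - a) + perturbation \<delta> p v + perturbation \<delta> q w)"
    for n y z p q
  have "\<exists>y z p q. sol n y z p q" for n
    unfolding sol_def B_def
    by (rule doubled_minimum[OF r \<delta> _ lsc _ _ G1 min])
       (use G_cont_B C1_on_imp_continuous_on[OF H] in \<open>auto simp: B_def\<close>)
  then obtain y z p q where sol: "\<And>n. sol n (y n) (z n) (p n) (q n)"
    by metis
  have yz: "y n \<in> B" "z n \<in> B"
    and le: "F (y n) - H (y n) + G (z n) + real n * \<theta> (y n - z n) + \<delta> * \<theta> (y n - a) \<le> F a - H a + G a" for n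
    using sol[of n] unfolding sol_def by blast+
  have opt: "F (y n) - H (y n) + G (z n) + real n * \<theta> (y n - z n) + \<delta> * \<theta> (y n - a)
         + perturbation \<delta> (p n) (y n) + perturbation \<delta> (q n) (z n) \<le>
       F v - H v + G w + real n * \<theta> (v - w) + \<delta> * \<theta> (v - a)
         + perturbation \<delta> (p n) v + perturbation \<delta> (q n) w" if "v \<in> B" "w \<in> B" for n v w
    using sol[of n] that unfolding sol_def by blast
  have pen0: "0 \<le> real n * \<theta> (y n - z n)" "0 \<le> \<delta> * \<theta> (y n - a)" for n
    using nonneg \<delta> by auto
  \<comment> \<open>Adding the minimality of \<open>F + G - H\<close> at \<open>a\<close>, tested at
    \<open>y n\<close>, to \<open>le\<close> cancels every term in \<open>F\<close> and
    \<open>H\<close>.\<close>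
  have key: "real n * \<theta> (y n - z n) + \<delta> * \<theta> (y n - a) \<le> G (y n) - G (z n)" for n
    using le[of n] min[of "y n"] yz(1)[of n] by (simp add: B_def)
  \<comment> \<open>Boundedness of \<open>G\<close> first gives only this rate, enough for
    \<open>y n - z n\<close> to tend to 0. Uniform continuity then upgrades \<open>key\<close>: the
    whole penalty, including the factor n, tends to 0.\<close>
  have "\<theta> (y n - z n) \<le> 2 / real n" if "0 < n" for n
  proof -
    have "real n * \<theta> (y n - z n) \<le> 2"
      using key[of n] pen0(2)[of n] G1[of "y n"] G1[of "z n"] yz[of n] unfolding B_def by linarith
    then show ?thesis using that by (simp add: field_simps)
  qed
  then have "\<forall>\<^sub>F n in sequentially. \<theta> (y n - z n) \<le> 2 / real n"
    by (auto simp: eventually_sequentially intro!: exI[of _ 1])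
  moreover have "(\<lambda>n. 2 / real n) \<longlonglongrightarrow> 0" by (rule lim_const_over_n)
  ultimately have "(\<lambda>n. \<theta> (y n - z n)) \<longlonglongrightarrow> 0"
    by (intro tendsto_sandwich[where f = "\<lambda>_. 0" and g = "\<lambda>n. \<theta> (y n - z n)"]) (auto simp: nonneg)
  then have u: "(\<lambda>n. y n - z n) \<longlonglongrightarrow> 0" by (rule tendsto_zeroI)
  then have "(\<lambda>n. dist (y n) (z n)) \<longlonglongrightarrow> 0" by (simp add: dist_norm tendsto_norm_zero)
  then have "(\<lambda>n. dist (G (y n)) (G (z n))) \<longlonglongrightarrow> 0"
    using uniformly_continuous_on_sequentially[THEN iffD1, OF G, rule_format, of y z] yz by (simp add: B_def)
  then have Gdiff: "(\<lambda>n. \<bar>G (y n) - G (z n)\<bar>) \<longlonglongrightarrow> 0" by (simp add: dist_real_def)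
  have le_G: "real n * \<theta> (y n - z n) \<le> \<bar>G (y n) - G (z n)\<bar>" "\<delta> * \<theta> (y n - a) \<le> \<bar>G (y n) - G (z n)\<bar>" for n
    using key[of n] pen0[of n] by linarith+
  have pen: "(\<lambda>n. real n * \<theta> (y n - z n)) \<longlonglongrightarrow> 0"
    by (rule tendsto_sandwich[OF _ _ tendsto_const Gdiff]) (use pen0 le_G in \<open>auto intro!: always_eventually\<close>)
  have "(\<lambda>n. \<delta> * \<theta> (y n - a)) \<longlonglongrightarrow> 0"
    by (rule tendsto_sandwich[OF _ _ tendsto_const Gdiff]) (use pen0 le_G in \<open>auto intro!: always_eventually\<close>)
  then have "(\<lambda>n. inverse \<delta> * (\<delta> * \<theta> (y n - a))) \<longlonglongrightarrow> inverse \<delta> * 0"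
    by (intro tendsto_intros)
  then have "(\<lambda>n. \<theta> (y n - a)) \<longlonglongrightarrow> 0" using \<delta> by simp
  then have "(\<lambda>n. y n - a) \<longlonglongrightarrow> 0" by (rule tendsto_zeroI)
  then have y: "y \<longlonglongrightarrow> a" by (rule LIM_zero_cancel)
  have z: "z \<longlonglongrightarrow> a" using tendsto_diff[OF y u] by simp
  have Hy: "(\<lambda>n. H (y n)) \<longlonglongrightarrow> H a" by (rule isCont_tendsto_compose[OF H_cont y])
  have H1y: "(\<lambda>n. H1 (y n)) \<longlonglongrightarrow> D"
    using isCont_tendsto_compose[OF H1_cont y] by (simp add: D)
  have Gy: "(\<lambda>n. G (y n)) \<longlonglongrightarrow> G a" by (rule isCont_tendsto_compose[OF G_cont y])
  have Gz: "(\<lambda>n. G (z n)) \<longlonglongrightarrow> G a" by (rule isCont_tendsto_compose[OF G_cont z])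
  \<comment> \<open>\<open>F\<close> need not be continuous. Minimality at \<open>a\<close> bounds
    \<open>F (y n)\<close> from below and \<open>le\<close> bounds it from above, and both bounds
    converge to \<open>F a\<close>.\<close>
  have Fy: "(\<lambda>n. F (y n)) \<longlonglongrightarrow> F a"
  proof (rule tendsto_sandwich)
    show "\<forall>\<^sub>F n in sequentially. F a + G a - H a + H (y n) - G (y n) \<le> F (y n)"
    proof (intro always_eventually allI)
      show "F a + G a - H a + H (y n) - G (y n) \<le> F (y n)" for n
        using min[of "y n"] yz(1)[of n] unfolding B_def by linarith
    qed
    show "\<forall>\<^sub>F n in sequentially. F (y n) \<le> F a - H a + G a + H (y n) - G (z n)"
    proof (intro always_eventually allI)
      show "F (y n) \<le> F a - H a + G a + H (y n) - G (z n)" for n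
        using le[of n] pen0[of n] by linarith
    qed
    show "(\<lambda>n. F a + G a - H a + H (y n) - G (y n)) \<longlonglongrightarrow> F a"
      using tendsto_diff[OF tendsto_add[OF tendsto_const[of "F a + G a - H a"] Hy] Gy] by simp
    show "(\<lambda>n. F a - H a + G a + H (y n) - G (z n)) \<longlonglongrightarrow> F a"
      using tendsto_diff[OF tendsto_add[OF tendsto_const[of "F a - H a + G a"] Hy] Gz] by simp
  qed
  define P where "P n = H1 (y n) - real n *\<^sub>R \<theta>' (y n - z n) - \<delta> *\<^sub>R \<theta>' (y n - a)
      - perturbation_deriv \<delta> (p n) (y n)" for n
  define Q where "Q n = real n *\<^sub>R \<theta>' (y n - z n) - perturbation_deriv \<delta> (q n) (z n)" for n
  have small_pert: "norm (perturbation_deriv \<delta> s w) \<le> \<epsilon> / 6" for s w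
    using perturbation(3)[OF \<delta>, of s w] \<delta>C by simp
  have small_loc: "norm (\<delta> *\<^sub>R \<theta>' w) \<le> \<epsilon> / 12" for w
    using deriv_bound[of w] \<delta> \<delta>C by (metis abs_of_pos mult_left_mono norm_scaleR less_imp_le)
  have "(\<lambda>n. norm (H1 (y n) - D)) \<longlonglongrightarrow> 0"
    using H1y by (simp add: tendsto_norm_zero LIM_zero)
  then have evD: "\<forall>\<^sub>F n in sequentially. norm (H1 (y n) - D) < \<epsilon> / 2"
    using \<epsilon> by (intro order_tendstoD(2)) auto
  have tri: "norm (u - v - w - s) \<le> norm u + norm v + norm w + norm s" for u v w s :: "'x \<Rightarrow>\<^sub>L real"
    using norm_triangle_ineq4[of "u - v - w" s] norm_triangle_ineq4[of "u - v" w] norm_triangle_ineq4[of u v]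
    by linarith
  have PQ: "norm (P n + Q n - D) \<le> norm (H1 (y n) - D) + 5 / 12 * \<epsilon>" for n
  proof -
    have "P n + Q n - D = (H1 (y n) - D) - \<delta> *\<^sub>R \<theta>' (y n - a)
        - perturbation_deriv \<delta> (p n) (y n) - perturbation_deriv \<delta> (q n) (z n)"
      by (simp add: P_def Q_def)
    also have "norm \<dots> \<le> norm (H1 (y n) - D) + norm (\<delta> *\<^sub>R \<theta>' (y n - a))
        + norm (perturbation_deriv \<delta> (p n) (y n)) + norm (perturbation_deriv \<delta> (q n) (z n))"
      by (rule tri)
    also have "\<dots> \<le> norm (H1 (y n) - D) + \<epsilon> / 12 + \<epsilon> / 6 + \<epsilon> / 6"
      by (intro add_mono small_pert small_loc order_refl)
    finally show ?thesis by simp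
  qed
  \<comment> \<open>A common bound for both subgradients. After multiplication by
    \<open>norm (y n - z n)\<close> its only critical term is
    \<open>C * (real n * (norm (y n - z n))\<^sup>2)\<close>.\<close>
  define M where "M n = norm (H1 (y n)) + real n * (C * norm (y n - z n)) + \<epsilon>" for n
  have pen_bound: "norm (real n *\<^sub>R \<theta>' (y n - z n)) \<le> real n * (C * norm (y n - z n))" for n
    using deriv_linear[of "y n - z n"] by (simp add: mult_left_mono)
  have PM: "norm (P n) \<le> M n" for n
  proof -
    have "norm (P n) \<le> norm (H1 (y n)) + norm (real n *\<^sub>R \<theta>' (y n - z n)) + norm (\<delta> *\<^sub>R \<theta>' (y n - a))
        + norm (perturbation_deriv \<delta> (p n) (y n))"
      unfolding P_def by (rule tri)
    with pen_bound[of n] small_loc[of "y n - a"] small_pert[of "p n" "y n"] \<epsilon> show ?thesis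
      unfolding M_def by linarith
  qed
  have QM: "norm (Q n) \<le> M n" for n
  proof -
    have "norm (Q n) \<le> norm (real n *\<^sub>R \<theta>' (y n - z n)) + norm (perturbation_deriv \<delta> (q n) (z n))"
      unfolding Q_def by (rule norm_triangle_ineq4)
    with pen_bound[of n] small_pert[of "q n" "z n"] \<epsilon> norm_ge_zero[of "H1 (y n)"] show ?thesis
      unfolding M_def by linarith
  qed
  \<comment> \<open>Only inside the unit ball does \<open>lower\<close> bound the squared norm by
    four times the gauge.\<close>
  have "\<forall>\<^sub>F n in sequentially. norm (y n - z n) < 1"
    using order_tendstoD(2)[OF tendsto_norm_zero[OF u], of 1] by simp
  then have "\<forall>\<^sub>F n in sequentially. real n * (norm (y n - z n))\<^sup>2 \<le> 4 * (real n * \<theta> (y n - z n))"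
  proof eventually_elim
    case (elim n)
    have "(norm (y n - z n))\<^sup>2 \<le> 1" using elim by (intro power_le_one) auto
    then have "(norm (y n - z n))\<^sup>2 \<le> 4 * \<theta> (y n - z n)" using lower[of "y n - z n"] by linarith
    then have "real n * (norm (y n - z n))\<^sup>2 \<le> real n * (4 * \<theta> (y n - z n))" by (rule mult_left_mono) simp
    then show ?case by simp
  qed
  moreover have "(\<lambda>n. 4 * (real n * \<theta> (y n - z n))) \<longlonglongrightarrow> 0" using tendsto_mult_right_zero[OF pen] .
  ultimately have nu2: "(\<lambda>n. real n * (norm (y n - z n))\<^sup>2) \<longlonglongrightarrow> 0"
    by (intro tendsto_sandwich[where f = "\<lambda>_. 0" and g = "\<lambda>n. real n * (norm (y n - z n))\<^sup>2"]) (assumption | simp)+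
  have "(\<lambda>n. norm (y n - z n) * (norm (H1 (y n)) + \<epsilon>) + C * (real n * (norm (y n - z n))\<^sup>2)) \<longlonglongrightarrow>
      0 * (norm D + \<epsilon>) + C * 0"
    by (intro tendsto_intros tendsto_norm_zero[OF u] H1y nu2)
  then have "(\<lambda>n. norm (y n - z n) * M n) \<longlonglongrightarrow> 0"
    by (simp add: M_def algebra_simps power2_eq_square)
  then have evM: "\<forall>\<^sub>F n in sequentially. norm (y n - z n) * M n < \<epsilon>"
    by (rule order_tendstoD(2)) (rule \<epsilon>)
  have near: "\<forall>\<^sub>F n in sequentially. dist (y n) a < min r \<epsilon>" "\<forall>\<^sub>F n in sequentially. dist (z n) a < min r \<epsilon>"
    "\<forall>\<^sub>F n in sequentially. dist (F (y n)) (F a) < \<epsilon>" "\<forall>\<^sub>F n in sequentially. dist (G (z n)) (G a) < \<epsilon>"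
    by (rule tendstoD[OF y] tendstoD[OF z] tendstoD[OF Fy] tendstoD[OF Gz]; use r \<epsilon> in simp)+
  have "\<forall>\<^sub>F n in sequentially. dist (y n) a < min r \<epsilon> \<and> dist (z n) a < min r \<epsilon> \<and> dist (F (y n)) (F a) < \<epsilon> \<and>
      dist (G (z n)) (G a) < \<epsilon> \<and> norm (H1 (y n) - D) < \<epsilon> / 2 \<and> norm (y n - z n) * M n < \<epsilon>"
    using near evD evM by eventually_elim simp
  then obtain n where n: "dist (y n) a < min r \<epsilon>" "dist (z n) a < min r \<epsilon>" "dist (F (y n)) (F a) < \<epsilon>"
      "dist (G (z n)) (G a) < \<epsilon>" "norm (H1 (y n) - D) < \<epsilon> / 2" "norm (y n - z n) * M n < \<epsilon>"
    by (auto simp: eventually_sequentially)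
  \<comment> \<open>\<open>S\<close> and \<open>T\<close> collect, with the sign reversed, the terms
    of \<open>opt\<close> other than \<open>F\<close> and \<open>G\<close> that depend on the free
    variable. Hence \<open>P n\<close> and \<open>Q n\<close> are their derivatives at
    \<open>y n\<close> and \<open>z n\<close>.\<close>
  define S where "S w = H w - real n * \<theta> (w - z n) - \<delta> * \<theta> (w - a) - perturbation \<delta> (p n) w" for w
  define S' where "S' w = H1 w - real n *\<^sub>R \<theta>' (w - z n) - \<delta> *\<^sub>R \<theta>' (w - a) - perturbation_deriv \<delta> (p n) w" for w
  define T where "T w = - (real n * \<theta> (y n - w)) - perturbation \<delta> (q n) w" for w
  define T' where "T' w = real n *\<^sub>R \<theta>' (y n - w) - perturbation_deriv \<delta> (q n) w" for w
  have dS: "(S has_derivative blinfun_apply (S' w)) (at w)" if "w \<in> B" for w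
  proof -
    have "(S has_derivative (\<lambda>h. H1 w h - real n * \<theta>' (w - z n) h - \<delta> * \<theta>' (w - a) h
        - perturbation_deriv \<delta> (p n) w h)) (at w)"
      unfolding S_def[abs_def]
      by (intro has_derivative_diff has_derivative_mult_right H1(1)[OF that] deriv_shift perturbation(1)[OF \<delta>])
    then show ?thesis
      by (rule has_derivative_eq_rhs) (simp add: fun_eq_iff S'_def blinfun.diff_left blinfun.scaleR_left)
  qed
  have cS: "C1_on B S"
    unfolding C1_on_def
  proof (intro exI[of _ S'] conjI ballI dS)
    show "continuous_on B S'"
      unfolding S'_def
      by (intro continuous_intros H1(2) cont_deriv_shift continuous_on_subset[OF perturbation(2)[OF \<delta>]]) auto
  qed
  have dT: "(T has_derivative blinfun_apply (T' w)) (at w)" for w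
  proof -
    have "(T has_derivative (\<lambda>h. - (real n * blinfun_apply (- \<theta>' (y n - w)) h)
        - perturbation_deriv \<delta> (q n) w h)) (at w)"
      unfolding T_def[abs_def]
      by (intro has_derivative_diff has_derivative_minus has_derivative_mult_right deriv_reflect perturbation(1)[OF \<delta>])
    then show ?thesis
      by (rule has_derivative_eq_rhs)
         (simp add: fun_eq_iff T'_def blinfun.diff_left blinfun.scaleR_left blinfun.minus_left)
  qed
  have cT: "C1_on B T"
    unfolding C1_on_def
  proof (intro exI[of _ T'] conjI ballI dT)
    show "continuous_on B T'"
      unfolding T'_def
      by (intro continuous_intros cont_deriv_reflect continuous_on_subset[OF perturbation(2)[OF \<delta>]]) auto
  qed
  have minS: "F (y n) - S (y n) \<le> F w - S w" if "w \<in> B" for w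
    using opt[OF that yz(2), of n n] by (simp add: S_def algebra_simps)
  have minT: "G (z n) - T (z n) \<le> G w - T w" if "w \<in> B" for w
    using opt[OF yz(1) that, of n n] by (simp add: T_def algebra_simps)
  have "norm (P n + Q n - D) < \<epsilon>" using PQ[of n] n(5) \<epsilon> by linarith
  moreover have "norm (y n - z n) * max (norm (P n)) (norm (Q n)) < \<epsilon>"
  proof -
    have "norm (y n - z n) * max (norm (P n)) (norm (Q n)) \<le> norm (y n - z n) * M n"
      using PM[of n] QM[of n] by (intro mult_left_mono) auto
    with n(6) show ?thesis by linarith
  qed
  moreover have "S' (y n) = P n" "T' (z n) = Q n" by (simp_all add: S'_def P_def T'_def Q_def)
  ultimately show ?thesis
    using n dS[OF yz(1), of n] dT[of "z n"] cS cT minS minT yz[of n]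
    by - (rule exI[of _ "y n"], rule exI[of _ "z n"], rule exI[of _ S], rule exI[of _ T], rule exI[of _ "P n"],
        rule exI[of _ "Q n"], auto simp: B_def dist_norm dist_real_def norm_minus_commute)
qed

end


section \<open>Charts and differentials\<close>

lemma chartsD:
  assumes "(U, \<phi>) \<in> charts A"
  shows "open U" "open (\<phi> ` U)" "continuous_on U \<phi>" "continuous_on (\<phi> ` U) (inv_into U \<phi>)"
    "\<And>x. x \<in> U \<Longrightarrow> inv_into U \<phi> (\<phi> x) = x" "inj_on \<phi> U"
proof -
  have ch: "open U" "open (\<phi> ` U)" and h: "homeomorphism U (\<phi> ` U) \<phi> (inv_into U \<phi>)"
    using assms by (auto simp: charts_def is_chart_def)
  then show "open U" "open (\<phi> ` U)" "continuous_on U \<phi>" "continuous_on (\<phi> ` U) (inv_into U \<phi>)"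
    "\<And>x. x \<in> U \<Longrightarrow> inv_into U \<phi> (\<phi> x) = x" "inj_on \<phi> U"
    by (auto simp: homeomorphism_def intro: inj_on_inverseI)
qed

lemma open_chart_image:
  assumes c: "(U, \<phi>) \<in> charts A" and W: "open W" "W \<subseteq> U"
  shows "open (\<phi> ` W)"
proof -
  have "open (inv_into U \<phi> -` W \<inter> \<phi> ` U)"
    using chartsD(2,4)[OF c] W(1) by (simp add: continuous_on_open_vimage)
  moreover have "inv_into U \<phi> -` W \<inter> \<phi> ` U = \<phi> ` W"
    using chartsD(5)[OF c] W(2) by (auto simp: image_iff)
  ultimately show ?thesis by simp
qed

lemma open_chart_vimage:
  assumes c: "(U, \<phi>) \<in> charts A" and V: "open V"
  shows "open (\<phi> -` V \<inter> U)"
  using chartsD(1,3)[OF c] V by (simp add: continuous_on_open_vimage)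

lemma atlas_subset_charts: "C1_atlas A \<Longrightarrow> A \<subseteq> charts A"
  by (auto simp: C1_atlas_def charts_def)

lemma atlas_chart_at:
  assumes "C1_atlas A"
  obtains U \<phi> where "(U, \<phi>) \<in> A" "(U, \<phi>) \<in> charts A" "x \<in> U"
proof -
  have "x \<in> \<Union> (fst ` A)" using assms by (simp add: C1_atlas_def)
  then obtain c where "c \<in> A" "x \<in> fst c" by auto
  then show ?thesis using that[of "fst c" "snd c"] atlas_subset_charts[OF assms] by auto
qed

text \<open>Members of \<open>charts A\<close> are by definition compatible only with the charts in
  \<open>A\<close>. Near each point the transition therefore factors through a chart of
  \<open>A\<close>.\<close>

lemma charts_C1_transition:
  assumes A: "C1_atlas A" and c: "(U, \<phi>) \<in> charts A" and d: "(V, \<psi>) \<in> charts A"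
  shows "C1_on (\<phi> ` (U \<inter> V)) (\<psi> \<circ> inv_into U \<phi>)"
proof (rule C1_on_open_cover)
  fix y assume "y \<in> \<phi> ` (U \<inter> V)"
  then obtain x where x: "x \<in> U" "x \<in> V" "y = \<phi> x" by auto
  obtain W \<tau> where W: "(W, \<tau>) \<in> A" "(W, \<tau>) \<in> charts A" "x \<in> W"
    by (rule atlas_chart_at[OF A])
  define T where "T = \<phi> ` (U \<inter> V \<inter> W)"
  have T: "open T" "y \<in> T"
    using open_chart_image[OF c, of "U \<inter> V \<inter> W"] chartsD(1)[OF c] chartsD(1)[OF d] chartsD(1)[OF W(2)] x W(3)
    by (auto simp: T_def)
  have "C1_on (\<phi> ` (U \<inter> W)) (\<tau> \<circ> inv_into U \<phi>)" "C1_on (\<tau> ` (W \<inter> V)) (\<psi> \<circ> inv_into W \<tau>)"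
    using c d W(1) by (auto simp: charts_def C1_compatible_def Int_commute)
  then have "C1_on T ((\<psi> \<circ> inv_into W \<tau>) \<circ> (\<tau> \<circ> inv_into U \<phi>))"
    by (intro C1_on_compose[of T _ "\<tau> ` (W \<inter> V)"])
       (auto simp: T_def chartsD(5)[OF c] intro: C1_on_subset)
  then have "C1_on T (\<psi> \<circ> inv_into U \<phi>)"
    by (rule C1_on_cong[OF T(1)]) (auto simp: T_def chartsD(5)[OF c] chartsD(5)[OF W(2)])
  with T show "\<exists>T. open T \<and> y \<in> T \<and> C1_on T (\<psi> \<circ> inv_into U \<phi>)" by blast
qed

lemma transition_has_derivative:
  assumes A: "C1_atlas A" and c: "(U, \<phi>) \<in> charts A" and d: "(V, \<psi>) \<in> charts A" and x: "x \<in> U" "x \<in> V"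
  shows "(\<psi> \<circ> inv_into U \<phi> has_derivative frechet_derivative (\<psi> \<circ> inv_into U \<phi>) (at (\<phi> x))) (at (\<phi> x))"
  using C1_on_imp_differentiable[OF charts_C1_transition[OF A c d], of "\<phi> x"] x
  by (auto simp: frechet_derivative_works)

lemma mem_chart_deriv_inv:
  assumes "(U, \<phi>) \<in> charts A" "x \<in> U"
  shows "((V, \<psi>), w) \<in> chart_deriv_inv A (U, \<phi>) x v \<longleftrightarrow>
    (V, \<psi>) \<in> charts A \<and> x \<in> V \<and> w = frechet_derivative (\<psi> \<circ> inv_into U \<phi>) (at (\<phi> x)) v"
  using assms by (auto simp: chart_deriv_inv_def tangent_rel_def)

lemma chart_deriv_inv_in_tangent_space:
  assumes "(U, \<phi>) \<in> charts A" "x \<in> U"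
  shows "chart_deriv_inv A (U, \<phi>) x v \<in> tangent_space A x"
  unfolding tangent_space_def chart_deriv_inv_def using assms by (intro quotientI) auto

lemma C1_funD:
  assumes "C1_fun A g" "(U, \<phi>) \<in> charts A" "x \<in> U"
  shows "(g \<circ> inv_into U \<phi> has_derivative frechet_derivative (g \<circ> inv_into U \<phi>) (at (\<phi> x))) (at (\<phi> x))"
  using assms C1_on_imp_differentiable[of "\<phi> ` U" "g \<circ> inv_into U \<phi>" "\<phi> x"]
  by (auto simp: C1_fun_def frechet_derivative_works)

text \<open>The chain rule for transition maps shows that all representatives of a tangent vector
  give the same value, so the description in \<open>differential\<close> is well defined and can be
  evaluated in the chosen chart.\<close>

lemma cotangent_rep_differential:
  assumes A: "C1_atlas A" and g: "C1_fun A g" and c: "(U, \<phi>) \<in> charts A" "x \<in> U"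
  shows "cotangent_rep A (U, \<phi>) x (differential A g x) =
    frechet_derivative (g \<circ> inv_into U \<phi>) (at (\<phi> x))"
proof
  fix v
  let ?D = "frechet_derivative (g \<circ> inv_into U \<phi>) (at (\<phi> x))"
  have same: "frechet_derivative (g \<circ> inv_into V \<psi>) (at (\<psi> x)) w = ?D v"
    if m: "((V, \<psi>), w) \<in> chart_deriv_inv A (U, \<phi>) x v" for V \<psi> w
  proof -
    have d: "(V, \<psi>) \<in> charts A" "x \<in> V" and w: "w = frechet_derivative (\<psi> \<circ> inv_into U \<phi>) (at (\<phi> x)) v"
      using m mem_chart_deriv_inv[OF c] by auto
    have x: "(\<psi> \<circ> inv_into U \<phi>) (\<phi> x) = \<psi> x" using chartsD(5)[OF c(1) c(2)] by simp
    have "((g \<circ> inv_into V \<psi>) \<circ> (\<psi> \<circ> inv_into U \<phi>) has_derivative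
        frechet_derivative (g \<circ> inv_into V \<psi>) (at (\<psi> x)) \<circ> frechet_derivative (\<psi> \<circ> inv_into U \<phi>) (at (\<phi> x))) (at (\<phi> x))"
      by (rule diff_chain_at[OF transition_has_derivative[OF A c(1) d(1) c(2) d(2)]])
         (unfold x, rule C1_funD[OF g d])
    then have "(g \<circ> inv_into U \<phi> has_derivative
        frechet_derivative (g \<circ> inv_into V \<psi>) (at (\<psi> x)) \<circ> frechet_derivative (\<psi> \<circ> inv_into U \<phi>) (at (\<phi> x))) (at (\<phi> x))"
    proof (rule has_derivative_transform_within_open)
      show "open (\<phi> ` (U \<inter> V))"
        using open_chart_image[OF c(1), of "U \<inter> V"] chartsD(1)[OF c(1)] chartsD(1)[OF d(1)] by auto
    qed (use c d chartsD(5)[OF c(1)] chartsD(5)[OF d(1)] in auto)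
    from has_derivative_unique[OF this C1_funD[OF g c]] w show ?thesis
      by (metis comp_apply)
  qed
  have "((U, \<phi>), frechet_derivative (\<phi> \<circ> inv_into U \<phi>) (at (\<phi> x)) v) \<in> chart_deriv_inv A (U, \<phi>) x v"
    using mem_chart_deriv_inv[OF c] c by simp
  with same have "(THE r. \<exists>V \<psi> w. ((V, \<psi>), w) \<in> chart_deriv_inv A (U, \<phi>) x v \<and>
      r = frechet_derivative (g \<circ> inv_into V \<psi>) (at (\<psi> x)) w) = ?D v"
    by (intro the_equality) (blast | metis)+
  then show "cotangent_rep A (U, \<phi>) x (differential A g x) v = ?D v"
    using chart_deriv_inv_in_tangent_space[OF c, of v]
    by (simp add: cotangent_rep_def differential_def)
qed

lemma cotangent_rep_has_derivative:
  assumes A: "C1_atlas A" and g: "C1_fun A g" and c: "(U, \<phi>) \<in> charts A" "x \<in> U"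
    and D: "(g \<circ> inv_into U \<phi> has_derivative D) (at (\<phi> x))"
  shows "cotangent_rep A (U, \<phi>) x (differential A g x) = D"
  unfolding cotangent_rep_differential[OF A g c] using frechet_derivative_at[OF D] by simp


section \<open>Extending test functions\<close>

text \<open>By the Hausdorff property, \<open>U\<close> and the open sets whose closure misses
  \<open>x\<close> cover the space. In a locally finite refinement, the members not contained in
  \<open>U\<close> have closures missing \<open>x\<close>, and local finiteness passes this to the
  closure of their union; its complement is the required neighbourhood.\<close>

lemma paracompact_imp_closure_subset:
  fixes x :: "'m::t2_space"
  assumes pc: "paracompact_space TYPE('m)" and U: "open U" "x \<in> U"
  obtains W where "open W" "x \<in> W" "closure W \<subseteq> U"
proof -
  define \<C> where "\<C> = insert U {V. open V \<and> x \<notin> closure V}"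
  have "\<Union> \<C> = UNIV"
  proof -
    have "y \<in> \<Union> \<C>" for y
    proof (cases "y = x")
      case True
      then show ?thesis using U(2) unfolding \<C>_def by blast
    next
      case False
      then obtain V V' where V: "open V" "open V'" "y \<in> V" "x \<in> V'" "V \<inter> V' = {}"
        using hausdorff[OF False] by blast
      have "closure V \<subseteq> - V'" by (rule closure_minimal) (use V in auto)
      with V(1,4) have "V \<in> \<C>" unfolding \<C>_def by blast
      with V(3) show ?thesis by blast
    qed
    then show ?thesis by (rule UNIV_eq_I[symmetric])
  qed
  moreover have "\<forall>C\<in>\<C>. open C" using U by (auto simp: \<C>_def)
  ultimately obtain \<D> where \<D>: "\<forall>D\<in>\<D>. open D \<and> (\<exists>C\<in>\<C>. D \<subseteq> C)" "\<Union> \<D> = UNIV"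
      "locally_finite_in euclidean \<D>"
    using pc[unfolded paracompact_space_def, THEN spec[of _ \<C>]] by blast
  define \<E> where "\<E> = {D\<in>\<D>. \<not> D \<subseteq> U}"
  have "locally_finite_in euclidean \<E>"
    using \<D>(3) by (rule locally_finite_in_subset) (auto simp: \<E>_def)
  then have cl: "closure (\<Union> \<E>) = \<Union> (closure ` \<E>)"
    using closure_of_locally_finite_Union[of euclidean \<E>] by simp
  have x: "x \<notin> closure (\<Union> \<E>)"
  proof -
    have "x \<notin> closure D" if D: "D \<in> \<E>" for D
    proof -
      have "D \<in> \<D>" using D by (simp add: \<E>_def)
      then obtain C where C: "C \<in> \<C>" "D \<subseteq> C" using bspec[OF \<D>(1)] by blast
      have "C \<noteq> U" using D C(2) by (auto simp: \<E>_def)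
      then have "x \<notin> closure C" using C(1) by (simp add: \<C>_def)
      then show ?thesis using closure_mono[OF C(2)] by auto
    qed
    then show ?thesis by (simp add: cl)
  qed
  show ?thesis
  proof
    show "open (- closure (\<Union> \<E>))" by (rule open_Compl[OF closed_closure])
    show "x \<in> - closure (\<Union> \<E>)" using x by (simp only: Compl_iff not_False_eq_True)
    have "open D" if "D \<in> \<E>" for D
      using bspec[OF \<D>(1), of D] that by (simp add: \<E>_def)
    then have "closed (- \<Union> \<E>)" by (intro closed_Compl open_Union ballI)
    moreover have "- closure (\<Union> \<E>) \<subseteq> - \<Union> \<E>" by (intro Compl_anti_mono closure_subset)
    ultimately have "closure (- closure (\<Union> \<E>)) \<subseteq> - \<Union> \<E>" by (rule closure_minimal[rotated])
    also have "\<dots> \<subseteq> U"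
    proof
      fix z assume z: "z \<in> - \<Union> \<E>"
      have "z \<in> \<Union> \<D>" unfolding \<D>(2) by (rule UNIV_I)
      then obtain D where D: "D \<in> \<D>" "z \<in> D" by (rule UnionE)
      then have "D \<notin> \<E>" using z by blast
      with D show "z \<in> U" unfolding \<E>_def by blast
    qed
    finally show "closure (- closure (\<Union> \<E>)) \<subseteq> U" .
  qed
qed

text \<open>
  A closed subset of the chart image need not have a closed preimage in the manifold; regularity
  provides balls for which this holds, so that the cut-off function extends by zero.
\<close>

lemma extend_chart_function:
  fixes A :: "('m::t2_space, 'x::banach) chart set"
  assumes A: "C1_atlas A" and pc: "paracompact_space TYPE('m)" and b: "C1_Lipschitz_bump (b :: 'x \<Rightarrow> real)"
    and c: "(U, \<phi>) \<in> charts A" "x \<in> U" and \<Omega>: "open \<Omega>" "\<phi> x \<in> \<Omega>" "C1_on \<Omega> S"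
  obtains h V where "C1_fun A h" "open V" "x \<in> V" "V \<subseteq> U" "\<phi> ` V \<subseteq> \<Omega>" "\<And>y. y \<in> V \<Longrightarrow> h y = S (\<phi> y)"
proof -
  obtain \<beta> :: "'x \<Rightarrow> real" and \<beta>' B L \<rho> where \<beta>: "\<And>u. (\<beta> has_derivative blinfun_apply (\<beta>' u)) (at u)"
      "continuous_on UNIV \<beta>'" "0 < \<rho>" "\<And>u. norm u < \<rho> \<Longrightarrow> \<beta> u = 0" "\<And>u. 1 \<le> norm u \<Longrightarrow> \<beta> u = 1"
    using bump_cutoff[OF b] by (elim exE conjE) blast
  have "open (U \<inter> (\<phi> -` \<Omega> \<inter> U))" "x \<in> U \<inter> (\<phi> -` \<Omega> \<inter> U)"
    using open_chart_vimage[OF c(1) \<Omega>(1)] chartsD(1)[OF c(1)] c \<Omega> by auto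
  then obtain W where W: "open W" "x \<in> W" "closure W \<subseteq> U \<inter> (\<phi> -` \<Omega> \<inter> U)"
    by (rule paracompact_imp_closure_subset[OF pc])
  have WU: "W \<subseteq> U" using W(3) closure_subset by blast
  obtain r where r: "r > 0" "cball (\<phi> x) r \<subseteq> \<phi> ` W"
    using open_chart_image[OF c(1) W(1) WU] W(2) open_contains_cball by blast
  define K where "K = \<phi> -` cball (\<phi> x) r \<inter> U"
  have KW: "K \<subseteq> W" using r(2) chartsD(6)[OF c(1)] WU by (fastforce simp: K_def dest: inj_onD)
  \<comment> \<open>Closed in the whole manifold, not merely in \<open>U\<close>: \<open>K\<close>
    lies in \<open>W\<close>, and \<open>\<phi>\<close> is continuous on the closed set
    \<open>closure W\<close>, which is contained in \<open>U\<close>.\<close>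
  have "closed K"
  proof -
    have "continuous_on (closure W) \<phi>" using W(3) by (intro continuous_on_subset[OF chartsD(3)[OF c(1)]]) auto
    then have "closed (closure W \<inter> \<phi> -` cball (\<phi> x) r)"
      by (intro continuous_closed_preimage) auto
    moreover have "closure W \<inter> \<phi> -` cball (\<phi> x) r = K"
      using KW W(3) closure_subset[of W] by (auto simp: K_def)
    ultimately show ?thesis by simp
  qed
  \<comment> \<open>Equal to 1 on the ball of radius \<open>\<rho> * r\<close> and to 0 outside the
    closed ball of radius \<open>r\<close>.\<close>
  define cut where "cut u = 1 - \<beta> ((u - \<phi> x) /\<^sub>R r)" for u
  have cut: "C1_on UNIV cut"
    unfolding C1_on_def
  proof (intro exI[of _ "\<lambda>u. (- (1 / r)) *\<^sub>R \<beta>' ((u - \<phi> x) /\<^sub>R r)"] conjI ballI)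
    fix u
    have "((\<lambda>u. (u - \<phi> x) /\<^sub>R r) has_derivative (\<lambda>h. h /\<^sub>R r)) (at u)"
      by (auto intro!: derivative_eq_intros)
    from diff_chain_at[OF this \<beta>(1)]
    have "((\<lambda>u. \<beta> ((u - \<phi> x) /\<^sub>R r)) has_derivative (\<lambda>h. \<beta>' ((u - \<phi> x) /\<^sub>R r) (h /\<^sub>R r))) (at u)"
      by (simp add: o_def)
    then have "(cut has_derivative (\<lambda>h. 0 - \<beta>' ((u - \<phi> x) /\<^sub>R r) (h /\<^sub>R r))) (at u)"
      unfolding cut_def[abs_def] by (intro has_derivative_diff has_derivative_const)
    then show "(cut has_derivative blinfun_apply ((- (1 / r)) *\<^sub>R \<beta>' ((u - \<phi> x) /\<^sub>R r))) (at u)"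
      by (rule has_derivative_eq_rhs)
         (simp add: fun_eq_iff blinfun.scaleR_left blinfun.scaleR_right blinfun.minus_left divide_inverse)
  next
    show "continuous_on UNIV (\<lambda>u. (- (1 / r)) *\<^sub>R \<beta>' ((u - \<phi> x) /\<^sub>R r))"
      by (intro continuous_intros continuous_on_compose2[OF \<beta>(2)]) auto
  qed
  have norm_r: "norm ((u - \<phi> x) /\<^sub>R r) = dist (\<phi> x) u / r" for u
    using r(1) by (simp only: norm_scaleR dist_norm norm_minus_commute[of u] abs_inverse abs_of_pos divide_inverse_commute)
  have cut_far: "cut u = 0" if "u \<notin> cball (\<phi> x) r" for u
  proof -
    have "r < dist (\<phi> x) u" using that by (simp only: mem_cball not_le)
    then have "1 \<le> dist (\<phi> x) u / r" using r(1) by (simp only: pos_le_divide_eq mult_1 less_imp_le)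
    then have "\<beta> ((u - \<phi> x) /\<^sub>R r) = 1" by (intro \<beta>(5)) (simp only: norm_r)
    then show ?thesis by (simp only: cut_def diff_self)
  qed
  have cut_near: "cut u = 1" if "u \<in> ball (\<phi> x) (\<rho> * r)" for u
  proof -
    have "dist (\<phi> x) u < \<rho> * r" using that by (simp only: mem_ball)
    then have "dist (\<phi> x) u / r < \<rho>" using r(1) by (simp only: pos_divide_less_eq)
    then have "\<beta> ((u - \<phi> x) /\<^sub>R r) = 0" by (intro \<beta>(4)) (simp only: norm_r)
    then show ?thesis by (simp only: cut_def diff_0_right)
  qed
  define h where "h y = (if y \<in> U then cut (\<phi> y) * S (\<phi> y) else 0)" for y
  have h0: "h y = 0" if "y \<notin> K" for y
    using that cut_far[of "\<phi> y"] by (auto simp: h_def K_def)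
  have "C1_fun A h"
    unfolding C1_fun_def
  proof (intro ballI case_prodI2)
    fix c' V \<psi> assume c': "c' \<in> charts A" "c' = (V, \<psi>)"
    then have d: "(V, \<psi>) \<in> charts A" by simp
    show "C1_on (\<psi> ` V) (h \<circ> inv_into V \<psi>)"
    proof (rule C1_on_open_cover)
      fix y assume "y \<in> \<psi> ` V"
      then obtain z where z: "z \<in> V" "y = \<psi> z" by auto
      show "\<exists>T. open T \<and> y \<in> T \<and> C1_on T (h \<circ> inv_into V \<psi>)"
      \<comment> \<open>As \<open>K \<subseteq> W\<close>, the open sets \<open>W\<close> and the
        complement of \<open>K\<close> cover the manifold. On the first \<open>h\<close> is a
        product of $C^1$ functions seen through a transition map, on the second it is 0.\<close>
      proof (cases "z \<in> W")
        case True
        define T where "T = \<psi> ` (V \<inter> W)"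
        have T: "open T" using open_chart_image[OF d, of "V \<inter> W"] chartsD(1)[OF d] W(1) by (auto simp: T_def)
        have "C1_on T (\<phi> \<circ> inv_into V \<psi>)"
          by (rule C1_on_subset[OF charts_C1_transition[OF A d c(1)]]) (use WU in \<open>auto simp: T_def\<close>)
        moreover have "C1_on \<Omega> (\<lambda>u. cut u * S u)"
          by (intro C1_on_mult \<Omega> C1_on_subset[OF cut]) auto
        ultimately have "C1_on T ((\<lambda>u. cut u * S u) \<circ> (\<phi> \<circ> inv_into V \<psi>))"
          by (rule C1_on_compose) (use W(3) closure_subset[of W] in \<open>auto simp: T_def chartsD(5)[OF d]\<close>)
        then have "C1_on T (h \<circ> inv_into V \<psi>)"
          by (rule C1_on_cong[OF T]) (use WU in \<open>auto simp: T_def chartsD(5)[OF d] h_def\<close>)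
        then show ?thesis using T z True by (intro exI[of _ T]) (auto simp: T_def)
      next
        case False
        define T where "T = \<psi> ` (V - K)"
        have T: "open T"
          using open_chart_image[OF d, of "V - K"] chartsD(1)[OF d] \<open>closed K\<close> by (auto simp: T_def)
        have "C1_on T (h \<circ> inv_into V \<psi>)"
          by (rule C1_on_cong[OF T C1_on_const[of _ 0]]) (auto simp: T_def chartsD(5)[OF d] h0)
        then show ?thesis using T z False KW by (intro exI[of _ T]) (auto simp: T_def)
      qed
    qed
  qed
  moreover define V where "V = W \<inter> (\<phi> -` ball (\<phi> x) (\<rho> * r) \<inter> U)"
  have "open V" unfolding V_def using W(1) open_chart_vimage[OF c(1)] by blast
  moreover have "x \<in> V" using W(2) c(2) \<beta>(3) r(1) by (simp add: V_def)
  moreover have "V \<subseteq> U" by (auto simp: V_def)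
  moreover have "\<phi> ` V \<subseteq> \<Omega>" using W(3) closure_subset[of W] by (auto simp: V_def)
  moreover have "h y = S (\<phi> y)" if "y \<in> V" for y
    using that by (auto simp: V_def h_def cut_near)
  ultimately show ?thesis by (rule that)
qed


section \<open>The Finsler distance in a chart\<close>

text \<open>Continuity of the curve keeps nearby times in \<open>U\<close>, so its expression in any
  other chart is the transition map applied to \<open>\<phi> \<circ> \<gamma>\<close> and the chain
  rule applies. The interval is nondegenerate, which makes the vector derivative unique.\<close>

lemma velocity_eq_chart_deriv_inv:
  assumes A: "C1_atlas A" and c: "(U, \<phi>) \<in> charts A" "\<gamma> t \<in> U" and t: "t \<in> {a..b}" "a < b"
    and v: "(\<phi> \<circ> \<gamma> has_vector_derivative v) (at t within {a..b})"
    and \<gamma>: "continuous (at t within {a..b}) \<gamma>"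
  shows "velocity A a b \<gamma> t = chart_deriv_inv A (U, \<phi>) (\<gamma> t) v"
proof -
  have "vector_derivative (\<psi> \<circ> \<gamma>) (at t within {a..b}) =
      frechet_derivative (\<psi> \<circ> inv_into U \<phi>) (at (\<phi> (\<gamma> t))) v"
    if d: "(V, \<psi>) \<in> charts A" "\<gamma> t \<in> V" for V \<psi>
  proof -
    let ?D = "frechet_derivative (\<psi> \<circ> inv_into U \<phi>) (at (\<phi> (\<gamma> t)))"
    have D: "(\<psi> \<circ> inv_into U \<phi> has_derivative ?D) (at (\<phi> (\<gamma> t)))"
      by (rule transition_has_derivative[OF A c(1) d(1) c(2) d(2)])
    have "(\<phi> \<circ> \<gamma> has_derivative (\<lambda>h. h *\<^sub>R v)) (at t within {a..b})"
      using v by (simp add: has_vector_derivative_def)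
    moreover have "(\<psi> \<circ> inv_into U \<phi> has_derivative ?D) (at ((\<phi> \<circ> \<gamma>) t) within (\<phi> \<circ> \<gamma>) ` {a..b})"
      using D by (simp add: has_derivative_at_withinI)
    ultimately have "((\<psi> \<circ> inv_into U \<phi>) \<circ> (\<phi> \<circ> \<gamma>) has_derivative ?D \<circ> (\<lambda>h. h *\<^sub>R v)) (at t within {a..b})"
      by (rule diff_chain_within)
    moreover have "?D \<circ> (\<lambda>h. h *\<^sub>R v) = (\<lambda>h. h *\<^sub>R ?D v)"
      using linear_scale[OF has_derivative_linear[OF D]] by (auto simp: o_def)
    ultimately have deriv: "((\<psi> \<circ> inv_into U \<phi>) \<circ> (\<phi> \<circ> \<gamma>) has_vector_derivative ?D v) (at t within {a..b})"
      by (simp add: has_vector_derivative_def)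
    have "\<forall>\<^sub>F s in at t within {a..b}. \<gamma> s \<in> U"
      using \<gamma> chartsD(1)[OF c(1)] c(2) unfolding continuous_within by (rule topological_tendstoD)
    then have ev: "\<forall>\<^sub>F s in nhds t. s \<in> {a..b} \<longrightarrow> ((\<psi> \<circ> inv_into U \<phi>) \<circ> (\<phi> \<circ> \<gamma>)) s = (\<psi> \<circ> \<gamma>) s"
      unfolding eventually_at_filter
    proof eventually_elim
      case (elim s)
      then show ?case using chartsD(5)[OF c(1)] c(2) by (cases "s = t") auto
    qed
    have "((\<psi> \<circ> inv_into U \<phi>) \<circ> (\<phi> \<circ> \<gamma>)) t = (\<psi> \<circ> \<gamma>) t"
      using chartsD(5)[OF c(1) c(2)] by simp
    from has_vector_derivative_cong_ev[OF ev this] deriv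
    have "(\<psi> \<circ> \<gamma> has_vector_derivative ?D v) (at t within {a..b})" by blast
    moreover have "at t within {a..b} \<noteq> bot"
      using t by (simp add: trivial_limit_within islimpt_Icc)
    ultimately show ?thesis using vector_derivative_within by blast
  qed
  then have "m \<in> velocity A a b \<gamma> t \<longleftrightarrow> m \<in> chart_deriv_inv A (U, \<phi>) (\<gamma> t) v" for m
    by (cases m; cases "fst m") (auto simp: velocity_def mem_chart_deriv_inv[OF c])
  then show ?thesis by blast
qed


text \<open>Provides the lower bound that the infimum in \<open>finsler_dist\<close> needs. Off the
  break points the velocity is a genuine tangent vector; at them the dummy value may have any sign
  under \<open>N\<close>, but finitely many points do not change the integral. A non-integrable
  speed has integral 0 by convention.\<close>

lemma curve_length_nonneg:
  assumes A: "C1_atlas A" and N: "finsler_P1 A N" and ab: "a < b" and \<gamma>: "piecewise_C1_curve_on A a b \<gamma>"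
  shows "0 \<le> curve_length A N a b \<gamma>"
proof -
  define L where "L t = N (\<gamma> t) (velocity A a b \<gamma> t)" for t
  obtain n s where s: "s 0 = a" "s n = b" "\<And>i. i < n \<Longrightarrow> C1_curve_on A (s i) (s (Suc i)) \<gamma>"
    using \<gamma> unfolding piecewise_C1_curve_on_def by blast
  define F where "F = s ` {..n}"
  have L: "0 \<le> L t" if t: "t \<in> {a..b}" "t \<notin> F" for t
  proof -
    have "\<exists>i<m. s i \<le> t \<and> t \<le> s (Suc i)" if "t \<le> s m" "m \<le> n" for m
      using that
    proof (induction m)
      case 0
      then show ?case using t s(1) by (auto simp: F_def)
    next
      case (Suc m)
      then show ?case by (cases "t \<le> s m") (auto intro: less_SucI)
    qed
    from this[of n] obtain i where i: "i < n" "s i \<le> t" "t \<le> s (Suc i)" using t(1) s(2) by auto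
    have "s i \<noteq> t" "s (Suc i) \<noteq> t" using t(2) i(1) by (auto simp: F_def)
    with i have st: "s i < t" "t < s (Suc i)" by auto
    obtain U \<phi> where c: "(U, \<phi>) \<in> charts A" "\<gamma> t \<in> U" by (rule atlas_chart_at[OF A])
    have \<gamma>i: "C1_curve_on A (s i) (s (Suc i)) \<gamma>" by (rule s(3)[OF i(1)])
    have "continuous_on {s i..s (Suc i)} \<gamma>" using \<gamma>i unfolding C1_curve_on_def by blast
    then have "isCont \<gamma> t" by (rule continuous_on_interior) (use st in simp)
    then have cont: "continuous (at t within {a..b}) \<gamma>" by (rule continuous_at_imp_continuous_at_within)
    obtain D where "(\<phi> \<circ> \<gamma> has_vector_derivative D t) (at t within {s i..s (Suc i)})"
      using \<gamma>i c i unfolding C1_curve_on_def by fastforce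
    then have "(\<phi> \<circ> \<gamma> has_vector_derivative D t) (at t)" using at_within_Icc_at[OF st] by simp
    then have "(\<phi> \<circ> \<gamma> has_vector_derivative D t) (at t within {a..b})"
      by (rule has_vector_derivative_at_within)
    then have "velocity A a b \<gamma> t = chart_deriv_inv A (U, \<phi>) (\<gamma> t) (D t)"
      by (rule velocity_eq_chart_deriv_inv[where \<gamma> = \<gamma>, OF A c t(1) ab _ cont])
    then have "velocity A a b \<gamma> t \<in> tangent_space A (\<gamma> t)"
      using chart_deriv_inv_in_tangent_space[OF c] by simp
    then show ?thesis
      using N unfolding finsler_P1_def is_norm_on_tangent_space_def L_def by blast
  qed
  have "0 \<le> integral {a..b} L"
  proof (cases "L integrable_on {a..b}")
    case True
    define L' where "L' t = (if t \<in> F then 0 else L t)" for t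
    have F: "finite F" by (simp add: F_def)
    have "L' integrable_on {a..b}"
      by (rule integrable_spike_finite[OF F _ True]) (auto simp: L'_def)
    then have "0 \<le> integral {a..b} L'"
      by (rule Henstock_Kurzweil_Integration.integral_nonneg) (use L in \<open>auto simp: L'_def\<close>)
    also have "integral {a..b} L' = integral {a..b} L"
      by (rule integral_spike[OF negligible_finite[OF F]]) (auto simp: L'_def)
    finally show ?thesis .
  qed (simp add: not_integrable_integral)
  then show ?thesis by (simp add: curve_length_def L_def[abs_def])
qed

text \<open>The preimage of the segment is an admissible curve on [0, 1] whose velocity in the chart
  is the constant vector \<open>w\<close>, so \<open>bound\<close> controls its speed and hence its
  length.\<close>

lemma finsler_dist_le_chart_segment:
  assumes A: "C1_atlas A" and N: "finsler_P1 A N" and c: "(U, \<phi>) \<in> charts A"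
    and pq: "p \<in> U" "q \<in> U" "closed_segment (\<phi> p) (\<phi> q) \<subseteq> \<phi> ` U" and K: "0 \<le> K"
    and bound: "\<And>x v. x \<in> U \<Longrightarrow> \<phi> x \<in> closed_segment (\<phi> p) (\<phi> q) \<Longrightarrow>
      N x (chart_deriv_inv A (U, \<phi>) x v) \<le> K * norm v"
  shows "finsler_dist A N p q \<le> K * norm (\<phi> p - \<phi> q)"
proof -
  define w where "w = \<phi> q - \<phi> p"
  define l where "l t = \<phi> p + t *\<^sub>R w" for t :: real
  define \<gamma> where "\<gamma> = inv_into U \<phi> \<circ> l"
  have l_seg: "l t \<in> closed_segment (\<phi> p) (\<phi> q)" if "t \<in> {0..1}" for t
    using that by (auto simp: closed_segment_def l_def w_def algebra_simps intro!: exI[of _ t])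
  have \<phi>\<gamma>: "\<phi> (\<gamma> t) = l t" "\<gamma> t \<in> U" if "t \<in> {0..1}" for t
    using l_seg[OF that] pq(3) by (auto simp: \<gamma>_def f_inv_into_f inv_into_into)
  have ends: "\<gamma> 0 = p" "\<gamma> 1 = q" using chartsD(5)[OF c] pq by (auto simp: \<gamma>_def l_def w_def)
  have dl: "(l has_derivative (\<lambda>h. h *\<^sub>R w)) (at t within T)" for t T
    unfolding l_def[abs_def] by (auto intro!: derivative_eq_intros)
  have cl: "continuous_on T l" for T unfolding l_def[abs_def] by (intro continuous_intros)
  have cont: "continuous_on {0..1} \<gamma>"
    unfolding \<gamma>_def o_def
    by (rule continuous_on_compose2[OF chartsD(4)[OF c] cl]) (use l_seg pq(3) in blast)
  have C1: "C1_curve_on A 0 1 \<gamma>"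
    unfolding C1_curve_on_def
  proof (intro conjI cont ballI case_prodI2)
    fix d V \<psi> assume "d \<in> charts A" "d = (V, \<psi>)"
    then have d: "(V, \<psi>) \<in> charts A" by simp
    obtain f' where f': "\<And>y. y \<in> \<phi> ` (U \<inter> V) \<Longrightarrow> (\<psi> \<circ> inv_into U \<phi> has_derivative blinfun_apply (f' y)) (at y)"
        "continuous_on (\<phi> ` (U \<inter> V)) f'"
      using charts_C1_transition[OF A c d] unfolding C1_on_def by blast
    have lV: "l t \<in> \<phi> ` (U \<inter> V)" if "t \<in> {0..1}" "\<gamma> t \<in> V" for t
      using \<phi>\<gamma>[OF that(1)] that(2) by (metis IntI imageI)
    show "\<exists>D. (\<forall>t\<in>{0..1}. \<gamma> t \<in> V \<longrightarrow> (\<psi> \<circ> \<gamma> has_vector_derivative D t) (at t within {0..1})) \<and>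
        continuous_on {t \<in> {0..1}. \<gamma> t \<in> V} D"
    proof (intro exI[of _ "\<lambda>t. f' (l t) w"] conjI ballI impI)
      fix t assume t: "t \<in> {0..1}" "\<gamma> t \<in> V"
      have "((\<psi> \<circ> inv_into U \<phi>) \<circ> l has_derivative blinfun_apply (f' (l t)) \<circ> (\<lambda>h. h *\<^sub>R w)) (at t within {0..1})"
        by (rule diff_chain_within[OF dl has_derivative_at_withinI[OF f'(1)[OF lV[OF t]]]])
      then show "(\<psi> \<circ> \<gamma> has_vector_derivative f' (l t) w) (at t within {0..1})"
        by (simp add: has_vector_derivative_def \<gamma>_def o_def blinfun.scaleR_right)
    next
      have "continuous_on {t \<in> {0..1}. \<gamma> t \<in> V} (\<lambda>t. f' (l t))"
        by (rule continuous_on_compose2[OF f'(2) cl]) (use lV in auto)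
      then show "continuous_on {t \<in> {0..1}. \<gamma> t \<in> V} (\<lambda>t. f' (l t) w)"
        by (intro continuous_intros)
    qed
  qed
  have pw: "piecewise_C1_curve_on A 0 1 \<gamma>"
    unfolding piecewise_C1_curve_on_def
    by (rule exI[of _ 1], rule exI[of _ real]) (use C1 in auto)
  have vel: "N (\<gamma> t) (velocity A 0 1 \<gamma> t) \<le> K * norm w" if t: "t \<in> {0..1}" for t
  proof -
    have "(l has_vector_derivative w) (at t within {0..1})" using dl by (simp add: has_vector_derivative_def)
    then have "(\<phi> \<circ> \<gamma> has_vector_derivative w) (at t within {0..1})"
      by (rule has_vector_derivative_transform[OF t, rotated]) (simp add: \<phi>\<gamma>)
    moreover have "continuous (at t within {0..1}) \<gamma>"
      using cont t continuous_on_eq_continuous_within by blast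
    ultimately have "velocity A 0 1 \<gamma> t = chart_deriv_inv A (U, \<phi>) (\<gamma> t) w"
      by (intro velocity_eq_chart_deriv_inv) (use A c \<phi>\<gamma>(2)[OF t] t in auto)
    then show ?thesis using bound[of "\<gamma> t" w] \<phi>\<gamma>[OF t] l_seg[OF t] by simp
  qed
  have "curve_length A N 0 1 \<gamma> \<le> K * norm w"
  proof (cases "(\<lambda>t. N (\<gamma> t) (velocity A 0 1 \<gamma> t)) integrable_on {0..1}")
    case True
    then have "curve_length A N 0 1 \<gamma> \<le> integral {0..1} (\<lambda>t::real. K * norm w)"
      unfolding curve_length_def by (rule integral_le) (use vel in auto)
    then show ?thesis by simp
  next
    case False
    then show ?thesis using K by (simp add: curve_length_def not_integrable_integral)
  qed
  moreover have "finsler_dist A N p q \<le> curve_length A N 0 1 \<gamma>"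
    unfolding finsler_dist_def
  proof (rule cInf_lower)
    show "curve_length A N 0 1 \<gamma> \<in> {curve_length A N a b c |a b c. a < b \<and> piecewise_C1_curve_on A a b c \<and> c a = p \<and> c b = q}"
      using pw ends by (intro CollectI exI[of _ 0] exI[of _ 1] exI[of _ \<gamma>]) auto
    show "bdd_below {curve_length A N a b c |a b c. a < b \<and> piecewise_C1_curve_on A a b c \<and> c a = p \<and> c b = q}"
      using curve_length_nonneg[OF A N] by (intro bdd_belowI[of _ 0]) blast
  qed
  ultimately show ?thesis by (simp add: w_def norm_minus_commute)
qed

text \<open>(P1) gives the constant at \<open>x\<close>, and (P2) with tolerance 1 at most doubles
  it on a neighbourhood. Balls are convex, so the segment joining two chart points of the ball stays
  where this bound holds.\<close>

lemma finsler_dist_le_chart_norm: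
  assumes M: "C1_finsler_manifold A N" and c: "(U, \<phi>) \<in> charts A" "x \<in> U"
  shows "\<exists>K>0. \<exists>r>0. ball (\<phi> x) r \<subseteq> \<phi> ` U \<and>
    (\<forall>p\<in>U. \<forall>q\<in>U. \<phi> p \<in> ball (\<phi> x) r \<longrightarrow> \<phi> q \<in> ball (\<phi> x) r \<longrightarrow>
       finsler_dist A N p q \<le> K * norm (\<phi> p - \<phi> q))"
proof -
  have A: "C1_atlas A" and P1: "finsler_P1 A N" and P2: "finsler_P2 A N"
    using M by (auto simp: C1_finsler_manifold_def)
  have "\<exists>k>0. \<exists>K>0. \<forall>v. k * norm v \<le> N x (chart_deriv_inv A (U, \<phi>) x v) \<and>
      N x (chart_deriv_inv A (U, \<phi>) x v) \<le> K * norm v"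
    using bspec[OF conjunct2[OF spec[OF P1[unfolded finsler_P1_def], of x]] c(1)] c(2) by simp
  then obtain K where K: "0 < K" "\<And>v. N x (chart_deriv_inv A (U, \<phi>) x v) \<le> K * norm v"
    by blast
  obtain W where W: "open W" "x \<in> W" "W \<subseteq> U"
    "\<And>z v. z \<in> W \<Longrightarrow> N z (chart_deriv_inv A (U, \<phi>) z v) \<le> (1 + 1) * N x (chart_deriv_inv A (U, \<phi>) x v)"
  proof -
    have "\<forall>\<epsilon>>0. \<forall>(U, \<phi>)\<in>charts A. x \<in> U \<longrightarrow> (\<exists>W. open W \<and> x \<in> W \<and> W \<subseteq> U \<and> (\<forall>z\<in>W. \<forall>v.
        1 / (1 + \<epsilon>) * N x (chart_deriv_inv A (U, \<phi>) x v) \<le> N z (chart_deriv_inv A (U, \<phi>) z v) \<and>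
        N z (chart_deriv_inv A (U, \<phi>) z v) \<le> (1 + \<epsilon>) * N x (chart_deriv_inv A (U, \<phi>) x v)))"
      using P2 unfolding finsler_P2_def by (rule spec)
    from bspec[OF mp[OF spec[OF this] zero_less_one] c(1)] c(2) show ?thesis
      by (simp only: prod.case simp_thms) (blast intro: that)
  qed
  obtain r where r: "0 < r" "ball (\<phi> x) r \<subseteq> \<phi> ` W"
    using open_chart_image[OF c(1) W(1,3)] W(2) open_contains_ball by blast
  have "finsler_dist A N p q \<le> (2 * K) * norm (\<phi> p - \<phi> q)"
    if pq: "p \<in> U" "q \<in> U" "\<phi> p \<in> ball (\<phi> x) r" "\<phi> q \<in> ball (\<phi> x) r" for p q
  proof (rule finsler_dist_le_chart_segment[OF A P1 c(1) pq(1,2)])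
    have seg: "closed_segment (\<phi> p) (\<phi> q) \<subseteq> ball (\<phi> x) r"
      using pq(3,4) by (intro closed_segment_subset convex_ball)
    then show "closed_segment (\<phi> p) (\<phi> q) \<subseteq> \<phi> ` U" using r(2) W(3) by blast
    fix z v assume z: "z \<in> U" "\<phi> z \<in> closed_segment (\<phi> p) (\<phi> q)"
    then obtain z' where "z' \<in> W" "\<phi> z = \<phi> z'" using seg r(2) by blast
    then have "z \<in> W" using z(1) W(3) chartsD(6)[OF c(1)] by (auto dest: inj_onD)
    from W(4)[OF this, of v] K(2)[of v]
    show "N z (chart_deriv_inv A (U, \<phi>) z v) \<le> (2 * K) * norm v" by (simp add: mult.assoc)
  qed (use K in simp)
  moreover have "ball (\<phi> x) r \<subseteq> \<phi> ` U" using r(2) image_mono[OF W(3)] by (rule subset_trans)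
  ultimately show ?thesis using K(1) r(1) by (intro exI[of _ "2 * K"] exI[of _ r] conjI ballI impI) simp_all
qed


section \<open>The fuzzy sum rule\<close>

text \<open>\<open>subdiff\<close> asks for test functions on the whole manifold. The extension
  agrees with \<open>S\<close> in the chart near the point, which preserves both the derivative and
  the local minimum.\<close>

lemma subdiff_from_chart:
  fixes A :: "('m::t2_space, 'x::banach) chart set"
  assumes A: "C1_atlas A" and pc: "paracompact_space TYPE('m)" and b: "C1_Lipschitz_bump (b :: 'x \<Rightarrow> real)"
    and c: "(U, \<phi>) \<in> charts A" and \<Omega>: "open \<Omega>" "\<Omega> \<subseteq> \<phi> ` U" "y \<in> \<Omega>"
    and S: "C1_on \<Omega> S" "(S has_derivative D) (at y)"
    and min: "\<And>w. w \<in> \<Omega> \<Longrightarrow> f (inv_into U \<phi> y) - S y \<le> f (inv_into U \<phi> w) - S w"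
  shows "\<exists>\<Delta>\<in>subdiff A (\<lambda>x. ereal (f x)) (inv_into U \<phi> y). cotangent_rep A (U, \<phi>) (inv_into U \<phi> y) \<Delta> = D"
proof -
  define x where "x = inv_into U \<phi> y"
  have x: "x \<in> U" "\<phi> x = y" using \<Omega> by (auto simp: x_def inv_into_into f_inv_into_f)
  obtain h V where h: "C1_fun A h" and V: "open V" "x \<in> V" "V \<subseteq> U" "\<phi> ` V \<subseteq> \<Omega>"
      and hS: "\<And>z. z \<in> V \<Longrightarrow> h z = S (\<phi> z)"
    by (rule extend_chart_function[OF A pc b c x(1) \<Omega>(1) _ S(1)]) (use x \<Omega> in auto)
  have "(h \<circ> inv_into U \<phi> has_derivative D) (at y)"
    by (rule has_derivative_transform_within_open[OF S(2) open_chart_image[OF c V(1,3)]])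
       (use x V hS chartsD(5)[OF c] in auto)
  then have "cotangent_rep A (U, \<phi>) x (differential A h x) = D"
    using cotangent_rep_has_derivative[OF A h c x(1)] x(2) by simp
  moreover have "f x - h x \<le> f z - h z" if "z \<in> V" for z
  proof -
    have "\<phi> z \<in> \<Omega>" "inv_into U \<phi> (\<phi> z) = z" using that V(3,4) chartsD(5)[OF c] by blast+
    then show ?thesis using min[of "\<phi> z"] hS[OF that] hS[OF V(2)] x(2) by (simp flip: x_def)
  qed
  then have "differential A h x \<in> subdiff A (\<lambda>x. ereal (f x)) x"
    unfolding subdiff_def local_min_at_def using h V by auto
  ultimately show ?thesis unfolding x_def by blast
qed

theorem proposition2p12:
  fixes A :: "('m::t2_space, 'x::banach) chart set"
    and N :: "'m \<Rightarrow> ('m, 'x) tangent \<Rightarrow> real"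
    and f g :: "'m \<Rightarrow> real"
  assumes "C1_finsler_manifold A N"
    and "\<exists>b :: 'x \<Rightarrow> real. C1_Lipschitz_bump b"
    and "lower_semicontinuous f"
    and "locally_uniformly_continuous (finsler_dist A N) g"
  shows "\<forall>x U \<phi> \<Delta> \<epsilon>. (U, \<phi>) \<in> charts A \<and> x \<in> U \<and>
      \<Delta> \<in> subdiff A (\<lambda>y. ereal (f y + g y)) x \<and> 0 < \<epsilon> \<longrightarrow>
    (\<exists>x1\<in>U. \<exists>x2\<in>U. \<exists>\<Delta>1\<in>subdiff A (\<lambda>y. ereal (f y)) x1. \<exists>\<Delta>2\<in>subdiff A (\<lambda>y. ereal (g y)) x2.
      finsler_dist A N x1 x < \<epsilon> \<and> finsler_dist A N x2 x < \<epsilon> \<and>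
      \<bar>f x1 - f x\<bar> < \<epsilon> \<and> \<bar>g x2 - g x\<bar> < \<epsilon> \<and>
      onorm (\<lambda>v. cotangent_rep A (U, \<phi>) x1 \<Delta>1 v + cotangent_rep A (U, \<phi>) x2 \<Delta>2 v
                   - cotangent_rep A (U, \<phi>) x \<Delta> v) < \<epsilon> \<and>
      finsler_dist A N x1 x2 *
        max (onorm (cotangent_rep A (U, \<phi>) x1 \<Delta>1)) (onorm (cotangent_rep A (U, \<phi>) x2 \<Delta>2)) < \<epsilon>)"
proof (intro allI impI, elim conjE)
  fix x U \<phi> \<Delta> and \<epsilon> :: real
  assume c: "(U, \<phi>) \<in> charts A" "x \<in> U" and \<Delta>: "\<Delta> \<in> subdiff A (\<lambda>y. ereal (f y + g y)) x" and \<epsilon>: "0 < \<epsilon>"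
  have A: "C1_atlas A" and pc: "paracompact_space TYPE('m)"
    using assms(1) by (auto simp: C1_finsler_manifold_def)
  obtain b :: "'x \<Rightarrow> real" where b: "C1_Lipschitz_bump b" using assms(2) by blast
  obtain \<theta> :: "'x \<Rightarrow> real" and \<theta>' C where "smooth_gauge \<theta> \<theta>' C" using bump_smooth_gauge[OF b] by blast
  then interpret smooth_gauge \<theta> \<theta>' C .
  obtain h where h: "C1_fun A h" "\<Delta> = differential A h x"
      and "local_min_at (\<lambda>y. ereal (f y + g y) - ereal (h y)) x"
    using \<Delta> unfolding subdiff_def by blast
  then obtain W1 where W1: "open W1" "x \<in> W1"
      and "\<forall>y\<in>W1. ereal (f x + g x) - ereal (h x) \<le> ereal (f y + g y) - ereal (h y)"
    unfolding local_min_at_def by blast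
  then have minW: "f x + g x - h x \<le> f y + g y - h y" if "y \<in> W1" for y
    using that by (metis ereal_less_eq(3) ereal_minus(1))
  obtain W2 where W2: "open W2" "x \<in> W2"
      and uc: "\<And>e. 0 < e \<Longrightarrow> \<exists>\<delta>>0. \<forall>y\<in>W2. \<forall>z\<in>W2. finsler_dist A N y z < \<delta> \<longrightarrow> \<bar>g y - g z\<bar> < e"
    using assms(4)[unfolded locally_uniformly_continuous_def, THEN spec[of _ x]] by blast
  obtain K r0 where K: "0 < K" and r0: "0 < r0" "ball (\<phi> x) r0 \<subseteq> \<phi> ` U"
      and dK: "\<And>p q. p \<in> U \<Longrightarrow> q \<in> U \<Longrightarrow> \<phi> p \<in> ball (\<phi> x) r0 \<Longrightarrow> \<phi> q \<in> ball (\<phi> x) r0 \<Longrightarrow>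
         finsler_dist A N p q \<le> K * norm (\<phi> p - \<phi> q)"
    using finsler_dist_le_chart_norm[OF assms(1) c] by blast
  define i where "i = inv_into U \<phi>"
  define a where "a = \<phi> x"
  have ia: "i a = x" using chartsD(5)[OF c] by (simp add: i_def a_def)
  obtain \<delta>1 where \<delta>1: "0 < \<delta>1" "\<And>y z. y \<in> W2 \<Longrightarrow> z \<in> W2 \<Longrightarrow> finsler_dist A N y z < \<delta>1 \<Longrightarrow> \<bar>g y - g z\<bar> < 1"
    using uc[of 1] by auto
  have W: "open (U \<inter> W1 \<inter> W2)" "U \<inter> W1 \<inter> W2 \<subseteq> U" using chartsD(1)[OF c(1)] W1 W2 by auto
  have "open (\<phi> ` (U \<inter> W1 \<inter> W2) \<inter> ball a r0)" using open_chart_image[OF c(1) W] by auto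
  moreover have "a \<in> \<phi> ` (U \<inter> W1 \<inter> W2) \<inter> ball a r0" using c W1 W2 r0 by (auto simp: a_def)
  ultimately obtain r1 where r1: "0 < r1" "cball a r1 \<subseteq> \<phi> ` (U \<inter> W1 \<inter> W2) \<inter> ball a r0"
    using open_contains_cball by blast
  \<comment> \<open>Within \<open>r1\<close> the chart stays in the neighbourhoods \<open>W1\<close>
    of minimality and \<open>W2\<close> of uniform continuity. The second bound gives
    \<open>K * r < \<delta>1\<close>, so that \<open>g\<close> varies by less than 1 from the
    centre.\<close>
  define r where "r = min r1 (\<delta>1 / (2 * K))"
  have r: "0 < r" "r \<le> r1" "K * r < \<delta>1" using r1 \<delta>1 K by (auto simp: r_def min_def field_simps)
  have B: "i y \<in> U" "i y \<in> W1" "i y \<in> W2" "\<phi> (i y) = y" "y \<in> ball a r0" if "y \<in> cball a r" for y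
  proof -
    have "y \<in> cball a r1" using that r(2) by simp
    then have y: "y \<in> \<phi> ` (U \<inter> W1 \<inter> W2)" "y \<in> ball a r0" using r1(2) by blast+
    then obtain w where w: "y = \<phi> w" "w \<in> U" "w \<in> W1" "w \<in> W2" by blast
    then have "i y = w" using chartsD(5)[OF c(1)] by (simp add: i_def)
    with w y(2) show "i y \<in> U" "i y \<in> W1" "i y \<in> W2" "\<phi> (i y) = y" "y \<in> ball a r0" by simp_all
  qed
  have B\<phi>: "cball a r \<subseteq> \<phi> ` U" using imageI[OF B(1), of _ \<phi>] by (simp add: B(4) subset_iff)
  have dist_i: "finsler_dist A N (i y) (i z) \<le> K * norm (y - z)" if "y \<in> cball a r" "z \<in> cball a r" for y z
    using dK[of "i y" "i z"] B[OF that(1)] B[OF that(2)] by (simp add: a_def)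
  define F where "F = f \<circ> i"
  define G where "G = g \<circ> i"
  define H where "H = h \<circ> i"
  have aB: "a \<in> cball a r" using r by simp
  have F: "closed {y \<in> cball a r. F y \<le> s}" for s
  proof -
    have "open {x. s < f x}" using assms(3) by (simp add: lower_semicontinuous_def)
    then have "closed {x. f x \<le> s}" by (simp add: closed_def Collect_neg_eq[symmetric] not_le)
    moreover have "continuous_on (cball a r) i"
      unfolding i_def by (rule continuous_on_subset[OF chartsD(4)[OF c(1)] B\<phi>])
    ultimately have "closed (cball a r \<inter> i -` {x. f x \<le> s})" by (intro continuous_closed_preimage) auto
    moreover have "cball a r \<inter> i -` {x. f x \<le> s} = {y \<in> cball a r. F y \<le> s}" by (auto simp: F_def)
    ultimately show ?thesis by simp
  qed
  have G: "uniformly_continuous_on (cball a r) G"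
    unfolding uniformly_continuous_on_def
  proof (intro allI impI)
    fix e :: real assume "0 < e"
    then obtain \<delta> where \<delta>: "0 < \<delta>" "\<And>y z. y \<in> W2 \<Longrightarrow> z \<in> W2 \<Longrightarrow> finsler_dist A N y z < \<delta> \<Longrightarrow> \<bar>g y - g z\<bar> < e"
      using uc by blast
    have "dist (G y) (G z) < e" if "z \<in> cball a r" "y \<in> cball a r" "dist y z < \<delta> / K" for y z
    proof -
      have "K * norm (y - z) < \<delta>" using that(3) K by (simp add: dist_norm field_simps)
      then have "finsler_dist A N (i y) (i z) < \<delta>" using dist_i[OF that(2,1)] by linarith
      then show ?thesis using \<delta>(2)[OF B(3)[OF that(2)] B(3)[OF that(1)]] by (simp add: G_def dist_real_def)
    qed
    then show "\<exists>d>0. \<forall>x\<in>cball a r. \<forall>x'\<in>cball a r. dist x' x < d \<longrightarrow> dist (G x') (G x) < e"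
      using \<delta>(1) K by (intro exI[of _ "\<delta> / K"] conjI ballI impI) (simp, blast)
  qed
  have G1: "\<forall>y\<in>cball a r. \<bar>G y - G a\<bar> \<le> 1"
  proof
    fix y assume y: "y \<in> cball a r"
    have "K * norm (y - a) \<le> K * r" using y K by (simp add: dist_norm norm_minus_commute)
    then have "finsler_dist A N (i y) (i a) < \<delta>1" using dist_i[OF y aB] r(3) by linarith
    then show "\<bar>G y - G a\<bar> \<le> 1" using \<delta>1(2)[of "i y" "i a"] B(3)[OF y] B(3)[OF aB] by (simp add: G_def)
  qed
  obtain H' where H': "\<And>y. y \<in> \<phi> ` U \<Longrightarrow> (H has_derivative blinfun_apply (H' y)) (at y)" "C1_on (\<phi> ` U) H"
    using h(1) c(1) unfolding C1_fun_def C1_on_def H_def i_def by fastforce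
  have H: "C1_on (cball a r) H" using H'(2) B\<phi> by (rule C1_on_subset)
  have Ha: "(H has_derivative blinfun_apply (H' a)) (at a)" using H'(1) c(2) by (simp add: a_def)
  have min: "\<forall>y\<in>cball a r. F a + G a - H a \<le> F y + G y - H y"
    using minW[OF B(2)] by (simp add: F_def G_def H_def ia)
  \<comment> \<open>Chart distances are multiplied by \<open>K\<close> when turned into Finsler
    distances, while the other estimates are used as they stand; dividing by \<open>K + 1\<close>
    serves both.\<close>
  define \<epsilon>' where "\<epsilon>' = \<epsilon> / (K + 1)"
  have \<epsilon>': "0 < \<epsilon>'" "\<epsilon>' \<le> \<epsilon>" "K * \<epsilon>' < \<epsilon>" using \<epsilon> K by (auto simp: \<epsilon>'_def field_simps)
  obtain y z S T P Q where yz: "y \<in> ball a r" "z \<in> ball a r" and near: "norm (y - a) < \<epsilon>'" "norm (z - a) < \<epsilon>'"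
    "\<bar>F y - F a\<bar> < \<epsilon>'" "\<bar>G z - G a\<bar> < \<epsilon>'"
    and S: "C1_on (cball a r) S" "(S has_derivative blinfun_apply P) (at y)"
      "\<forall>w\<in>cball a r. F y - S y \<le> F w - S w"
    and T: "C1_on (cball a r) T" "(T has_derivative blinfun_apply Q) (at z)"
      "\<forall>w\<in>cball a r. G z - T z \<le> G w - T w"
    and PQ: "norm (P + Q - H' a) < \<epsilon>'" "norm (y - z) * max (norm P) (norm Q) < \<epsilon>'"
    using fuzzy_sum_rule[OF r(1) \<epsilon>'(1) F G H Ha G1 min]
    by (elim exE conjE) (rule that; assumption)
  have yzc: "y \<in> cball a r" "z \<in> cball a r" using yz by auto
  have sub: "ball a r \<subseteq> \<phi> ` U" using B\<phi> by auto
  obtain \<Delta>1 where \<Delta>1: "\<Delta>1 \<in> subdiff A (\<lambda>y. ereal (f y)) (i y)" "cotangent_rep A (U, \<phi>) (i y) \<Delta>1 = blinfun_apply P"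
    using subdiff_from_chart[OF A pc b c(1) open_ball sub yz(1) C1_on_subset[OF S(1) ball_subset_cball] S(2), of f] S(3)
    by (auto simp: F_def i_def)
  obtain \<Delta>2 where \<Delta>2: "\<Delta>2 \<in> subdiff A (\<lambda>y. ereal (g y)) (i z)" "cotangent_rep A (U, \<phi>) (i z) \<Delta>2 = blinfun_apply Q"
    using subdiff_from_chart[OF A pc b c(1) open_ball sub yz(2) C1_on_subset[OF T(1) ball_subset_cball] T(2), of g] T(3)
    by (auto simp: G_def i_def)
  have rep: "cotangent_rep A (U, \<phi>) x \<Delta> = blinfun_apply (H' a)"
    unfolding h(2) by (rule cotangent_rep_has_derivative[OF A h(1) c]) (use Ha in \<open>simp add: H_def i_def a_def\<close>)
  have "K * norm (y - a) \<le> K * \<epsilon>'" "K * norm (z - a) \<le> K * \<epsilon>'" using near K by simp_all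
  then have "finsler_dist A N (i y) x < \<epsilon>" "finsler_dist A N (i z) x < \<epsilon>"
    using dist_i[OF yzc(1) aB] dist_i[OF yzc(2) aB] \<epsilon>'(3) by (auto simp: ia)
  moreover have "\<bar>f (i y) - f x\<bar> < \<epsilon>" "\<bar>g (i z) - g x\<bar> < \<epsilon>"
    using near \<epsilon>'(2) by (auto simp: F_def G_def ia)
  moreover have "onorm (\<lambda>v. blinfun_apply P v + blinfun_apply Q v - blinfun_apply (H' a) v) < \<epsilon>"
  proof -
    have "(\<lambda>v. blinfun_apply P v + blinfun_apply Q v - blinfun_apply (H' a) v) = blinfun_apply (P + Q - H' a)"
      by (simp add: fun_eq_iff blinfun.add_left blinfun.diff_left)
    then show ?thesis using PQ(1) \<epsilon>'(2) by (simp add: norm_blinfun.rep_eq)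
  qed
  moreover have "finsler_dist A N (i y) (i z) * max (onorm (blinfun_apply P)) (onorm (blinfun_apply Q)) < \<epsilon>"
  proof -
    have "finsler_dist A N (i y) (i z) * max (norm P) (norm Q) \<le> K * norm (y - z) * max (norm P) (norm Q)"
      using dist_i[OF yzc] by (rule mult_right_mono) (simp add: le_max_iff_disj)
    also have "\<dots> \<le> K * \<epsilon>'" using PQ(2) K by (simp add: mult.assoc)
    finally show ?thesis using \<epsilon>'(3) by (simp add: norm_blinfun.rep_eq)
  qed
  ultimately show "\<exists>x1\<in>U. \<exists>x2\<in>U. \<exists>\<Delta>1\<in>subdiff A (\<lambda>y. ereal (f y)) x1. \<exists>\<Delta>2\<in>subdiff A (\<lambda>y. ereal (g y)) x2.
      finsler_dist A N x1 x < \<epsilon> \<and> finsler_dist A N x2 x < \<epsilon> \<and>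
      \<bar>f x1 - f x\<bar> < \<epsilon> \<and> \<bar>g x2 - g x\<bar> < \<epsilon> \<and>
      onorm (\<lambda>v. cotangent_rep A (U, \<phi>) x1 \<Delta>1 v + cotangent_rep A (U, \<phi>) x2 \<Delta>2 v
                   - cotangent_rep A (U, \<phi>) x \<Delta> v) < \<epsilon> \<and>
      finsler_dist A N x1 x2 *
        max (onorm (cotangent_rep A (U, \<phi>) x1 \<Delta>1)) (onorm (cotangent_rep A (U, \<phi>) x2 \<Delta>2)) < \<epsilon>"
    using B(1)[OF yzc(1)] B(1)[OF yzc(2)] \<Delta>1 \<Delta>2 rep
    by (intro bexI[of _ "i y"] bexI[of _ "i z"] bexI[of _ \<Delta>1] bexI[of _ \<Delta>2]) simp_all
qed

end
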